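(* (Linearity.) In the $!$-free fragment described in the context, let $A$ be a proposition, $B\in\mathcal V$, $t$ a proof-term with $x^A\vdash t:B$, and $u_1,u_2$ closed proof-terms of $A$ (i.e. $\vdash u_1:A$ and $\vdash u_2:A$). Then for every $a\in\mathcal S$, $t\{u_1\boxplus u_2\}\equiv t\{u_1\}\boxplus t\{u_2\}$ and $t\{a\bullet u_1\}\equiv a\bullet t\{u_1\}$.
   Context: Let $\mathcal S$ be a semiring. ($!$-free fragment of the $\mathcal{L}^{\mathcal S}_2$-calculus.) Propositions (modulo $\alpha$): $A ::= X \mid \mathbf 1 \mid A\multimap A\mid A\otimes A\mid \top\mid \mathbf 0\mid A\,\&\,A\mid A\oplus A\mid \forall X.A$. Proof-terms (modulo $\alpha$; $a\in\mathcal S$): $t ::= x \mid t\boxplus u\mid a\bullet t\mid a.\star\mid \delta_{\mathbf 1}(t,u)\mid \lambda x^A.t\mid t\,u\mid t\otimes u\mid \delta_\otimes(t,x^Ay^B.u)\mid\langle\rangle\mid \delta_{\mathbf 0}(t) \mid \langle t,u\rangle\mid \delta^1_\&(t,x^A.u)\mid\delta^2_\&(t,x^B.u)\mid \mathrm{inl}(t)\mid\mathrm{inr}(t)\mid\delta_\oplus(t,x^A.u,y^B.v)\mid\Lambda X.t\mid t\,A$ ($\boxplus$: proof-term sum). Sequents $\Gamma\vdash t:A$ with $\Gamma$ a linear context ($\Gamma,\Delta$ disjoint union). Rules: $x^A\vdash x:A$; from $\Gamma\vdash t:A$ and $\Gamma\vdash u:A$ infer $\Gamma\vdash t\boxplus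 u:A$; from $\Gamma\vdash t:A$ infer $\Gamma\vdash a\bullet t:A$; $\vdash a.\star:\mathbf 1$; from $\Gamma\vdash t:\mathbf 1$, $\Delta\vdash u:A$ infer $\Gamma,\Delta\vdash\delta_{\mathbf 1}(t,u):A$; from $\Gamma,x^A\vdash t:B$ infer $\Gamma\vdash\lambda x^A.t:A\multimap B$; from $\Gamma\vdash t:A\multimap B$, $\Delta\vdash u:A$ infer $\Gamma,\Delta\vdash t\,u:B$; from $\Gamma\vdash t:A$, $\Delta\vdash u:B$ infer $\Gamma,\Delta\vdash t\otimes u:A\otimes B$; from $\Gamma\vdash t:A\otimes B$, $\Delta,x^A,y^B\vdash u:C$ infer $\Gamma,\Delta\vdash\delta_\otimes(t,x^Ay^B.u):C$; $\Gamma\vdash\langle\rangle:\top$; from $\Gamma\vdash t:\mathbf 0$ infer $\Gamma,\Delta\vdash\delta_{\mathbf 0}(t):C$; from $\Gamma\vdash t:A$, $\Gamma\vdash u:B$ infer $\Gamma\vdash\langle t,u\rangle:A\&B$; from $\Gamma\vdash t:A\&B$, $\Delta,x^A\vdash u:C$ infer $\Gamma,\Delta\vdash\delta^1_\&(t,x^A.u):C$; from $\Gamma\vdash t:A\&B$, $\Delta,x^B\vdash u:C$ infer $\Gamma,\Delta\vdash\delta^2_\&(t,x^B.u):C$; from $\Gamma\vdash t:A$ infer $\Gamma\vdash\mathrm{inl}(t):A\oplus B$; from $\Gamma\vdash t:B$ infer $\Gamma\vdash\mathrm{inr}(t):A\oplus B$; from $\Gamma\vdash t:A\oplus B$, $\Delta,x^A\vdash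 u:C$, $\Delta,y^B\vdash v:C$ infer $\Gamma,\Delta\vdash\delta_\oplus(t,x^A.u,y^B.v):C$; from $\Gamma\vdash t:A$ with $X\notin FV(\Gamma)$ infer $\Gamma\vdash\Lambda X.t:\forall X.A$; from $\Gamma\vdash t:\forall X.B$ infer $\Gamma\vdash t\,A:(A/X)B$. Reduction $\to$ is the closure under all contexts of: $\delta_{\mathbf 1}(a.\star,t)\to a\bullet t$; $(\lambda x^A.t)\,u\to(u/x)t$; $\delta_\otimes(u\otimes v,x^Ay^B.w)\to(u/x,v/y)w$; $\delta^i_\&(\langle t_1,t_2\rangle,x.v)\to(t_i/x)v$; $\delta_\oplus(\mathrm{inl}(t),x^A.v,y^B.w)\to(t/x)v$; $\delta_\oplus(\mathrm{inr}(u),x^A.v,y^B.w)\to(u/y)w$; $(\Lambda X.t)\,A\to(A/X)t$; $a.\star\boxplus b.\star\to(a+b).\star$; $(\lambda x^A.t)\boxplus(\lambda x^A.u)\to\lambda x^A.(t\boxplus u)$; $\delta_\otimes(t\boxplus u,x^Ay^B.v)\to\delta_\otimes(t,x^Ay^B.v)\boxplus\delta_\otimes(u,x^Ay^B.v)$; $\langle\rangle\boxplus\langle\rangle\to\langle\rangle$; $\langle t,u\rangle\boxplus\langle v,w\rangle\to\langle t\boxplus v,u\boxplus w\rangle$; $\delta_\oplus(t\boxplus u,x^A.v,y^B.w)\to\delta_\oplus(t,x^A.v,y^B.w)\boxplus\delta_\oplus(u,x^A.v,y^B.w)$; $(\Lambda X.t)\boxplus(\Lambda X.u)\to\Lambda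 X.(t\boxplus u)$; $a\bullet b.\star\to(a\times b).\star$; $a\bullet\lambda x^A.t\to\lambda x^A.a\bullet t$; $\delta_\otimes(a\bullet t,x^Ay^B.v)\to a\bullet\delta_\otimes(t,x^Ay^B.v)$; $a\bullet\langle\rangle\to\langle\rangle$; $a\bullet\langle t,u\rangle\to\langle a\bullet t,a\bullet u\rangle$; $\delta_\oplus(a\bullet t,x^A.v,y^B.w)\to a\bullet\delta_\oplus(t,x^A.v,y^B.w)$; $a\bullet\Lambda X.t\to\Lambda X.a\bullet t$. $\equiv$ is the reflexive-symmetric-transitive closure of $\to$. $\mathcal V$ is the smallest set of propositions containing $\mathbf 1$ and closed under $A,B\mapsto A\&B$. For $t$ with the single free variable $x$, $t\{u\}$ denotes $(u/x)t$.
   Formalization: The equivalence t{a•u1} ≡ a•t{u1} is proved for every a commuting with all scalars (so every a if S is commutative); for noncommutative S it fails, e.g. t = b•x, u1 = 1.⋆ gives (b×a).⋆ versus (a×b).⋆. *)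

theory Defs
  imports Main
begin

section \<open>Propositions\<close>

text \<open>Propositions and proof-terms modulo alpha-equivalence are represented by de Bruijn
  indices, with separate index spaces for propositional variables and for proof-term
  variables.\<close>

datatype fml =
    PVar nat
  | One
  | Lolli fml fml
  | Tensor fml fml
  | Top
  | Zero
  | With fml fml
  | Plus fml fml
  | All fml

definition up_ren :: "(nat \<Rightarrow> nat) \<Rightarrow> nat \<Rightarrow> nat" where
  "up_ren \<rho> = case_nat 0 (\<lambda>n. Suc (\<rho> n))"

primrec pren :: "(nat \<Rightarrow> nat) \<Rightarrow> fml \<Rightarrow> fml" where
  "pren \<rho> (PVar n) = PVar (\<rho> n)"
| "pren \<rho> One = One"
| "pren \<rho> (Lolli A B) = Lolli (pren \<rho> A) (pren \<rho> B)"
| "pren \<rho> (Tensor A B) = Tensor (pren \<rho> A) (pren \<rho> B)"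
| "pren \<rho> Top = Top"
| "pren \<rho> Zero = Zero"
| "pren \<rho> (With A B) = With (pren \<rho> A) (pren \<rho> B)"
| "pren \<rho> (Plus A B) = Plus (pren \<rho> A) (pren \<rho> B)"
| "pren \<rho> (All A) = All (pren (up_ren \<rho>) A)"

definition up_psubst :: "(nat \<Rightarrow> fml) \<Rightarrow> nat \<Rightarrow> fml" where
  "up_psubst \<tau> = case_nat (PVar 0) (\<lambda>n. pren Suc (\<tau> n))"

primrec psubst :: "(nat \<Rightarrow> fml) \<Rightarrow> fml \<Rightarrow> fml" where
  "psubst \<tau> (PVar n) = \<tau> n"
| "psubst \<tau> One = One"
| "psubst \<tau> (Lolli A B) = Lolli (psubst \<tau> A) (psubst \<tau> B)"
| "psubst \<tau> (Tensor A B) = Tensor (psubst \<tau> A) (psubst \<tau> B)"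
| "psubst \<tau> Top = Top"
| "psubst \<tau> Zero = Zero"
| "psubst \<tau> (With A B) = With (psubst \<tau> A) (psubst \<tau> B)"
| "psubst \<tau> (Plus A B) = Plus (psubst \<tau> A) (psubst \<tau> B)"
| "psubst \<tau> (All A) = All (psubst (up_psubst \<tau>) A)"

inductive_set VV :: "fml set" where
  VV_One: "One \<in> VV"
| VV_With: "A \<in> VV \<Longrightarrow> B \<in> VV \<Longrightarrow> With A B \<in> VV"


section \<open>Proof-terms\<close>

text \<open>Binding structure: \<open>Lam A t\<close> binds index 0 in \<open>t\<close>; \<open>TensorE t A B u\<close> binds in \<open>u\<close>
  the variable of type \<open>A\<close> as index 1 and that of type \<open>B\<close> as index 0;
  \<open>WithE1 t A u\<close> and \<open>WithE2 t A u\<close> bind index 0 in \<open>u\<close>; \<open>PlusE t A u B v\<close> binds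
  index 0 in \<open>u\<close> (of type \<open>A\<close>) and in \<open>v\<close> (of type \<open>B\<close>);
  \<open>TLam t\<close> binds propositional index 0 in \<open>t\<close>.\<close>

datatype 's trm =
    Var nat
  | Sum "'s trm" "'s trm"                        (infixl "\<boxplus>" 65)
  | Scal 's "'s trm"                             (infixr "\<bullet>\<^sub>s" 75)
  | Star 's
  | OneE "'s trm" "'s trm"
  | Lam fml "'s trm"
  | App "'s trm" "'s trm"
  | Tens "'s trm" "'s trm"
  | TensorE "'s trm" fml fml "'s trm"
  | Unit
  | ZeroE "'s trm"
  | Pair "'s trm" "'s trm"
  | WithE1 "'s trm" fml "'s trm"
  | WithE2 "'s trm" fml "'s trm"
  | InL "'s trm"
  | InR "'s trm"
  | PlusE "'s trm" fml "'s trm" fml "'s trm"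
  | TLam "'s trm"
  | TApp "'s trm" fml

primrec tren :: "(nat \<Rightarrow> nat) \<Rightarrow> 's trm \<Rightarrow> 's trm" where
  "tren \<rho> (Var n) = Var (\<rho> n)"
| "tren \<rho> (t \<boxplus> u) = tren \<rho> t \<boxplus> tren \<rho> u"
| "tren \<rho> (a \<bullet>\<^sub>s t) = a \<bullet>\<^sub>s tren \<rho> t"
| "tren \<rho> (Star a) = Star a"
| "tren \<rho> (OneE t u) = OneE (tren \<rho> t) (tren \<rho> u)"
| "tren \<rho> (Lam A t) = Lam A (tren (up_ren \<rho>) t)"
| "tren \<rho> (App t u) = App (tren \<rho> t) (tren \<rho> u)"
| "tren \<rho> (Tens t u) = Tens (tren \<rho> t) (tren \<rho> u)"
| "tren \<rho> (TensorE t A B u) = TensorE (tren \<rho> t) A B (tren (up_ren (up_ren \<rho>)) u)"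
| "tren \<rho> Unit = Unit"
| "tren \<rho> (ZeroE t) = ZeroE (tren \<rho> t)"
| "tren \<rho> (Pair t u) = Pair (tren \<rho> t) (tren \<rho> u)"
| "tren \<rho> (WithE1 t A u) = WithE1 (tren \<rho> t) A (tren (up_ren \<rho>) u)"
| "tren \<rho> (WithE2 t A u) = WithE2 (tren \<rho> t) A (tren (up_ren \<rho>) u)"
| "tren \<rho> (InL t) = InL (tren \<rho> t)"
| "tren \<rho> (InR t) = InR (tren \<rho> t)"
| "tren \<rho> (PlusE t A u B v) =
     PlusE (tren \<rho> t) A (tren (up_ren \<rho>) u) B (tren (up_ren \<rho>) v)"
| "tren \<rho> (TLam t) = TLam (tren \<rho> t)"
| "tren \<rho> (TApp t A) = TApp (tren \<rho> t) A"

primrec tpsubst :: "(nat \<Rightarrow> fml) \<Rightarrow> 's trm \<Rightarrow> 's trm" where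
  "tpsubst \<tau> (Var n) = Var n"
| "tpsubst \<tau> (t \<boxplus> u) = tpsubst \<tau> t \<boxplus> tpsubst \<tau> u"
| "tpsubst \<tau> (a \<bullet>\<^sub>s t) = a \<bullet>\<^sub>s tpsubst \<tau> t"
| "tpsubst \<tau> (Star a) = Star a"
| "tpsubst \<tau> (OneE t u) = OneE (tpsubst \<tau> t) (tpsubst \<tau> u)"
| "tpsubst \<tau> (Lam A t) = Lam (psubst \<tau> A) (tpsubst \<tau> t)"
| "tpsubst \<tau> (App t u) = App (tpsubst \<tau> t) (tpsubst \<tau> u)"
| "tpsubst \<tau> (Tens t u) = Tens (tpsubst \<tau> t) (tpsubst \<tau> u)"
| "tpsubst \<tau> (TensorE t A B u) =
     TensorE (tpsubst \<tau> t) (psubst \<tau> A) (psubst \<tau> B) (tpsubst \<tau> u)"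
| "tpsubst \<tau> Unit = Unit"
| "tpsubst \<tau> (ZeroE t) = ZeroE (tpsubst \<tau> t)"
| "tpsubst \<tau> (Pair t u) = Pair (tpsubst \<tau> t) (tpsubst \<tau> u)"
| "tpsubst \<tau> (WithE1 t A u) = WithE1 (tpsubst \<tau> t) (psubst \<tau> A) (tpsubst \<tau> u)"
| "tpsubst \<tau> (WithE2 t A u) = WithE2 (tpsubst \<tau> t) (psubst \<tau> A) (tpsubst \<tau> u)"
| "tpsubst \<tau> (InL t) = InL (tpsubst \<tau> t)"
| "tpsubst \<tau> (InR t) = InR (tpsubst \<tau> t)"
| "tpsubst \<tau> (PlusE t A u B v) =
     PlusE (tpsubst \<tau> t) (psubst \<tau> A) (tpsubst \<tau> u) (psubst \<tau> B) (tpsubst \<tau> v)"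
| "tpsubst \<tau> (TLam t) = TLam (tpsubst (up_psubst \<tau>) t)"
| "tpsubst \<tau> (TApp t A) = TApp (tpsubst \<tau> t) (psubst \<tau> A)"

definition up_tsubst :: "(nat \<Rightarrow> 's trm) \<Rightarrow> nat \<Rightarrow> 's trm" where
  "up_tsubst \<sigma> = case_nat (Var 0) (\<lambda>n. tren Suc (\<sigma> n))"

text \<open>Simultaneous capture-avoiding substitution. Under \<open>TLam\<close> the propositional variables
  of the substituted terms are shifted.\<close>

primrec tsubst :: "(nat \<Rightarrow> 's trm) \<Rightarrow> 's trm \<Rightarrow> 's trm" where
  "tsubst \<sigma> (Var n) = \<sigma> n"
| "tsubst \<sigma> (t \<boxplus> u) = tsubst \<sigma> t \<boxplus> tsubst \<sigma> u"
| "tsubst \<sigma> (a \<bullet>\<^sub>s t) = a \<bullet>\<^sub>s tsubst \<sigma> t"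
| "tsubst \<sigma> (Star a) = Star a"
| "tsubst \<sigma> (OneE t u) = OneE (tsubst \<sigma> t) (tsubst \<sigma> u)"
| "tsubst \<sigma> (Lam A t) = Lam A (tsubst (up_tsubst \<sigma>) t)"
| "tsubst \<sigma> (App t u) = App (tsubst \<sigma> t) (tsubst \<sigma> u)"
| "tsubst \<sigma> (Tens t u) = Tens (tsubst \<sigma> t) (tsubst \<sigma> u)"
| "tsubst \<sigma> (TensorE t A B u) =
     TensorE (tsubst \<sigma> t) A B (tsubst (up_tsubst (up_tsubst \<sigma>)) u)"
| "tsubst \<sigma> Unit = Unit"
| "tsubst \<sigma> (ZeroE t) = ZeroE (tsubst \<sigma> t)"
| "tsubst \<sigma> (Pair t u) = Pair (tsubst \<sigma> t) (tsubst \<sigma> u)"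
| "tsubst \<sigma> (WithE1 t A u) = WithE1 (tsubst \<sigma> t) A (tsubst (up_tsubst \<sigma>) u)"
| "tsubst \<sigma> (WithE2 t A u) = WithE2 (tsubst \<sigma> t) A (tsubst (up_tsubst \<sigma>) u)"
| "tsubst \<sigma> (InL t) = InL (tsubst \<sigma> t)"
| "tsubst \<sigma> (InR t) = InR (tsubst \<sigma> t)"
| "tsubst \<sigma> (PlusE t A u B v) =
     PlusE (tsubst \<sigma> t) A (tsubst (up_tsubst \<sigma>) u) B (tsubst (up_tsubst \<sigma>) v)"
| "tsubst \<sigma> (TLam t) = TLam (tsubst (\<lambda>n. tpsubst (\<lambda>k. PVar (Suc k)) (\<sigma> n)) t)"
| "tsubst \<sigma> (TApp t A) = TApp (tsubst \<sigma> t) A"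

text \<open>\<open>subst1\<close>, \<open>subst2\<close> and \<open>psubst1\<close>, \<open>tpsubst1\<close> instantiate the outermost bound
  indices and lower the remaining ones; in \<open>subst2 u v w\<close>, \<open>u\<close> goes to index 1 and \<open>v\<close>
  to index 0, simultaneously. In contrast, \<open>fsubst x u t\<close> replaces the
  free variable \<open>x\<close> by \<open>u\<close> and leaves all other free variables unchanged.\<close>

definition subst1 :: "'s trm \<Rightarrow> 's trm \<Rightarrow> 's trm" where
  "subst1 u t = tsubst (case_nat u Var) t"

definition subst2 :: "'s trm \<Rightarrow> 's trm \<Rightarrow> 's trm \<Rightarrow> 's trm" where
  "subst2 u v w = tsubst (case_nat v (case_nat u Var)) w"

definition psubst1 :: "fml \<Rightarrow> fml \<Rightarrow> fml" where
  "psubst1 A B = psubst (case_nat A PVar) B"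

definition tpsubst1 :: "fml \<Rightarrow> 's trm \<Rightarrow> 's trm" where
  "tpsubst1 A t = tpsubst (case_nat A PVar) t"

definition fsubst :: "nat \<Rightarrow> 's trm \<Rightarrow> 's trm \<Rightarrow> 's trm" where
  "fsubst x u t = tsubst (Var(x := u)) t"


section \<open>Typing\<close>

text \<open>A context is a finite partial map from variables to propositions. Finiteness is
  imposed in the only two rules that introduce an arbitrary context, so every
  derivable sequent has a finite context. \<open>A \<rhd> \<Gamma>\<close> extends \<open>\<Gamma>\<close> with a fresh index 0.\<close>

type_synonym ctx = "nat \<rightharpoonup> fml"

definition ext :: "fml \<Rightarrow> ctx \<Rightarrow> ctx" (infixr "\<rhd>" 70) where
  "A \<rhd> \<Gamma> = case_nat (Some A) \<Gamma>"

definition disj :: "ctx \<Rightarrow> ctx \<Rightarrow> bool" (infix "\<bottom>" 50) where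
  "\<Gamma> \<bottom> \<Delta> \<longleftrightarrow> dom \<Gamma> \<inter> dom \<Delta> = {}"

text \<open>In \<open>T_TLam\<close>, shifting the propositions of \<open>\<Gamma>\<close> expresses that the quantified variable
  does not occur free in \<open>\<Gamma>\<close>.\<close>

inductive typed :: "ctx \<Rightarrow> 's trm \<Rightarrow> fml \<Rightarrow> bool" ("_ \<turnstile> _ \<^bold>: _" [60, 60, 60] 50) where
  T_Var: "[x \<mapsto> A] \<turnstile> Var x \<^bold>: A"
| T_Sum: "\<Gamma> \<turnstile> t \<^bold>: A \<Longrightarrow> \<Gamma> \<turnstile> u \<^bold>: A \<Longrightarrow> \<Gamma> \<turnstile> t \<boxplus> u \<^bold>: A"
| T_Scal: "\<Gamma> \<turnstile> t \<^bold>: A \<Longrightarrow> \<Gamma> \<turnstile> a \<bullet>\<^sub>s t \<^bold>: A"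
| T_Star: "Map.empty \<turnstile> Star a \<^bold>: One"
| T_OneE: "\<Gamma> \<turnstile> t \<^bold>: One \<Longrightarrow> \<Delta> \<turnstile> u \<^bold>: A \<Longrightarrow> \<Gamma> \<bottom> \<Delta> \<Longrightarrow> \<Gamma> ++ \<Delta> \<turnstile> OneE t u \<^bold>: A"
| T_Lam: "A \<rhd> \<Gamma> \<turnstile> t \<^bold>: B \<Longrightarrow> \<Gamma> \<turnstile> Lam A t \<^bold>: Lolli A B"
| T_App: "\<Gamma> \<turnstile> t \<^bold>: Lolli A B \<Longrightarrow> \<Delta> \<turnstile> u \<^bold>: A \<Longrightarrow> \<Gamma> \<bottom> \<Delta> \<Longrightarrow> \<Gamma> ++ \<Delta> \<turnstile> App t u \<^bold>: B"
| T_Tens: "\<Gamma> \<turnstile> t \<^bold>: A \<Longrightarrow> \<Delta> \<turnstile> u \<^bold>: B \<Longrightarrow> \<Gamma> \<bottom> \<Delta> \<Longrightarrow> \<Gamma> ++ \<Delta> \<turnstile> Tens t u \<^bold>: Tensor A B"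
| T_TensorE: "\<Gamma> \<turnstile> t \<^bold>: Tensor A B \<Longrightarrow> B \<rhd> A \<rhd> \<Delta> \<turnstile> u \<^bold>: C \<Longrightarrow> \<Gamma> \<bottom> \<Delta> \<Longrightarrow>
    \<Gamma> ++ \<Delta> \<turnstile> TensorE t A B u \<^bold>: C"
| T_Unit: "finite (dom \<Gamma>) \<Longrightarrow> \<Gamma> \<turnstile> Unit \<^bold>: Top"
| T_ZeroE: "\<Gamma> \<turnstile> t \<^bold>: Zero \<Longrightarrow> finite (dom \<Delta>) \<Longrightarrow> \<Gamma> \<bottom> \<Delta> \<Longrightarrow> \<Gamma> ++ \<Delta> \<turnstile> ZeroE t \<^bold>: C"
| T_Pair: "\<Gamma> \<turnstile> t \<^bold>: A \<Longrightarrow> \<Gamma> \<turnstile> u \<^bold>: B \<Longrightarrow> \<Gamma> \<turnstile> Pair t u \<^bold>: With A B"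
| T_WithE1: "\<Gamma> \<turnstile> t \<^bold>: With A B \<Longrightarrow> A \<rhd> \<Delta> \<turnstile> u \<^bold>: C \<Longrightarrow> \<Gamma> \<bottom> \<Delta> \<Longrightarrow>
    \<Gamma> ++ \<Delta> \<turnstile> WithE1 t A u \<^bold>: C"
| T_WithE2: "\<Gamma> \<turnstile> t \<^bold>: With A B \<Longrightarrow> B \<rhd> \<Delta> \<turnstile> u \<^bold>: C \<Longrightarrow> \<Gamma> \<bottom> \<Delta> \<Longrightarrow>
    \<Gamma> ++ \<Delta> \<turnstile> WithE2 t B u \<^bold>: C"
| T_InL: "\<Gamma> \<turnstile> t \<^bold>: A \<Longrightarrow> \<Gamma> \<turnstile> InL t \<^bold>: Plus A B"
| T_InR: "\<Gamma> \<turnstile> t \<^bold>: B \<Longrightarrow> \<Gamma> \<turnstile> InR t \<^bold>: Plus A B"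
| T_PlusE: "\<Gamma> \<turnstile> t \<^bold>: Plus A B \<Longrightarrow> A \<rhd> \<Delta> \<turnstile> u \<^bold>: C \<Longrightarrow> B \<rhd> \<Delta> \<turnstile> v \<^bold>: C \<Longrightarrow> \<Gamma> \<bottom> \<Delta> \<Longrightarrow>
    \<Gamma> ++ \<Delta> \<turnstile> PlusE t A u B v \<^bold>: C"
| T_TLam: "(\<lambda>x. map_option (pren Suc) (\<Gamma> x)) \<turnstile> t \<^bold>: A \<Longrightarrow> \<Gamma> \<turnstile> TLam t \<^bold>: All A"
| T_TApp: "\<Gamma> \<turnstile> t \<^bold>: All B \<Longrightarrow> \<Gamma> \<turnstile> TApp t A \<^bold>: psubst1 A B"


section \<open>Reduction\<close>

inductive red :: "'s::{plus,times} trm \<Rightarrow> 's trm \<Rightarrow> bool" (infix "\<leadsto>" 50) where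
  R_One: "OneE (Star a) t \<leadsto> a \<bullet>\<^sub>s t"
| R_Lam: "App (Lam A t) u \<leadsto> subst1 u t"
| R_Tens: "TensorE (Tens u v) A B w \<leadsto> subst2 u v w"
| R_With1: "WithE1 (Pair t1 t2) A v \<leadsto> subst1 t1 v"
| R_With2: "WithE2 (Pair t1 t2) A v \<leadsto> subst1 t2 v"
| R_PlusL: "PlusE (InL t) A v B w \<leadsto> subst1 t v"
| R_PlusR: "PlusE (InR u) A v B w \<leadsto> subst1 u w"
| R_TLam: "TApp (TLam t) A \<leadsto> tpsubst1 A t"
| R_Sum_Star: "Star a \<boxplus> Star b \<leadsto> Star (a + b)"
| R_Sum_Lam: "Lam A t \<boxplus> Lam A u \<leadsto> Lam A (t \<boxplus> u)"
| R_Sum_TensorE: "TensorE (t \<boxplus> u) A B v \<leadsto> TensorE t A B v \<boxplus> TensorE u A B v"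
| R_Sum_Unit: "Unit \<boxplus> Unit \<leadsto> Unit"
| R_Sum_Pair: "Pair t u \<boxplus> Pair v w \<leadsto> Pair (t \<boxplus> v) (u \<boxplus> w)"
| R_Sum_PlusE: "PlusE (t \<boxplus> u) A v B w \<leadsto> PlusE t A v B w \<boxplus> PlusE u A v B w"
| R_Sum_TLam: "TLam t \<boxplus> TLam u \<leadsto> TLam (t \<boxplus> u)"
| R_Scal_Star: "a \<bullet>\<^sub>s Star b \<leadsto> Star (a * b)"
| R_Scal_Lam: "a \<bullet>\<^sub>s Lam A t \<leadsto> Lam A (a \<bullet>\<^sub>s t)"
| R_Scal_TensorE: "TensorE (a \<bullet>\<^sub>s t) A B v \<leadsto> a \<bullet>\<^sub>s TensorE t A B v"
| R_Scal_Unit: "a \<bullet>\<^sub>s Unit \<leadsto> Unit"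
| R_Scal_Pair: "a \<bullet>\<^sub>s Pair t u \<leadsto> Pair (a \<bullet>\<^sub>s t) (a \<bullet>\<^sub>s u)"
| R_Scal_PlusE: "PlusE (a \<bullet>\<^sub>s t) A v B w \<leadsto> a \<bullet>\<^sub>s PlusE t A v B w"
| R_Scal_TLam: "a \<bullet>\<^sub>s TLam t \<leadsto> TLam (a \<bullet>\<^sub>s t)"
| C_Sum1: "t \<leadsto> t' \<Longrightarrow> t \<boxplus> u \<leadsto> t' \<boxplus> u"
| C_Sum2: "u \<leadsto> u' \<Longrightarrow> t \<boxplus> u \<leadsto> t \<boxplus> u'"
| C_Scal: "t \<leadsto> t' \<Longrightarrow> a \<bullet>\<^sub>s t \<leadsto> a \<bullet>\<^sub>s t'"
| C_OneE1: "t \<leadsto> t' \<Longrightarrow> OneE t u \<leadsto> OneE t' u"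
| C_OneE2: "u \<leadsto> u' \<Longrightarrow> OneE t u \<leadsto> OneE t u'"
| C_Lam: "t \<leadsto> t' \<Longrightarrow> Lam A t \<leadsto> Lam A t'"
| C_App1: "t \<leadsto> t' \<Longrightarrow> App t u \<leadsto> App t' u"
| C_App2: "u \<leadsto> u' \<Longrightarrow> App t u \<leadsto> App t u'"
| C_Tens1: "t \<leadsto> t' \<Longrightarrow> Tens t u \<leadsto> Tens t' u"
| C_Tens2: "u \<leadsto> u' \<Longrightarrow> Tens t u \<leadsto> Tens t u'"
| C_TensorE1: "t \<leadsto> t' \<Longrightarrow> TensorE t A B u \<leadsto> TensorE t' A B u"
| C_TensorE2: "u \<leadsto> u' \<Longrightarrow> TensorE t A B u \<leadsto> TensorE t A B u'"
| C_ZeroE: "t \<leadsto> t' \<Longrightarrow> ZeroE t \<leadsto> ZeroE t'"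
| C_Pair1: "t \<leadsto> t' \<Longrightarrow> Pair t u \<leadsto> Pair t' u"
| C_Pair2: "u \<leadsto> u' \<Longrightarrow> Pair t u \<leadsto> Pair t u'"
| C_WithE1_1: "t \<leadsto> t' \<Longrightarrow> WithE1 t A u \<leadsto> WithE1 t' A u"
| C_WithE1_2: "u \<leadsto> u' \<Longrightarrow> WithE1 t A u \<leadsto> WithE1 t A u'"
| C_WithE2_1: "t \<leadsto> t' \<Longrightarrow> WithE2 t A u \<leadsto> WithE2 t' A u"
| C_WithE2_2: "u \<leadsto> u' \<Longrightarrow> WithE2 t A u \<leadsto> WithE2 t A u'"
| C_InL: "t \<leadsto> t' \<Longrightarrow> InL t \<leadsto> InL t'"
| C_InR: "t \<leadsto> t' \<Longrightarrow> InR t \<leadsto> InR t'"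
| C_PlusE1: "t \<leadsto> t' \<Longrightarrow> PlusE t A u B v \<leadsto> PlusE t' A u B v"
| C_PlusE2: "u \<leadsto> u' \<Longrightarrow> PlusE t A u B v \<leadsto> PlusE t A u' B v"
| C_PlusE3: "v \<leadsto> v' \<Longrightarrow> PlusE t A u B v \<leadsto> PlusE t A u B v'"
| C_TLam: "t \<leadsto> t' \<Longrightarrow> TLam t \<leadsto> TLam t'"
| C_TApp: "t \<leadsto> t' \<Longrightarrow> TApp t A \<leadsto> TApp t' A"

abbreviation red_equiv :: "'s::{plus,times} trm \<Rightarrow> 's trm \<Rightarrow> bool" (infix "\<simeq>" 50) where
  "t \<simeq> u \<equiv> equivclp red t u"

end

theory Submission
  imports Defs
begin

text \<open>Propositions are interpreted as partial equivalence relations on proof-terms that are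
  closed under conversion and whose quotient is a module over the semiring (without zero). \<open>Lolli\<close>
  becomes the linear maps, \<open>Tensor\<close> and \<open>Plus\<close> the free modules generated by the introduction terms
  modulo (bi)linearity, and the quantifier an intersection over all such relations, as for
  reducibility candidates. Every typable term is then linear in each of its variables up to
  these relations, and on \<open>VV\<close> they are contained in conversion. Neither normalisation nor
  confluence nor subject reduction is needed: that \<open>Zero\<close> has no closed term, for instance,
  is simply that its relation is empty.\<close>

section \<open>Substitution calculus\<close>

text \<open>No reduction rule moves a sum out of \<open>Tens\<close>, \<open>InL\<close> or
  \<open>InR\<close>, so conversion alone is too fine for an induction on \<open>t\<close>: a
  coarser relation is needed at those types, which must still fall back to conversion on
  \<open>VV\<close>. Moreover \<open>App\<close>, \<open>OneE\<close>, \<open>WithE1\<close>,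
  \<open>WithE2\<close> and \<open>TApp\<close> have no rule distributing them over sums. They are
  additive only on terms known to convert to an introduction, and each relation carries that
  knowledge in its domain. The relations speak of raw terms without typing, so that the quantifier
  can pair any type argument with any candidate. The scalars are central for a reason: with
  \<open>t = Scal b (Var x)\<close> and \<open>u1 = Star c\<close>, the two sides of the scalar
  equation reduce to \<open>Star (b * (a * c))\<close> and
  \<open>Star (a * (b * c))\<close>.\<close>

lemma case_nat_o_Suc: "case_nat a g \<circ> Suc = g"
  by (rule ext) simp

lemma case_nat_up_ren: "case_nat a g \<circ> up_ren \<rho> = case_nat a (g \<circ> \<rho>)"
  by (rule ext) (simp add: up_ren_def split: nat.split)

lemma up_ren_comp: "up_ren \<rho> \<circ> up_ren \<rho>' = up_ren (\<rho> \<circ> \<rho>')"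
  by (rule ext) (simp add: up_ren_def split: nat.split)

lemma pren_pren: "pren \<rho> (pren \<rho>' A) = pren (\<rho> \<circ> \<rho>') A"
  by (induction A arbitrary: \<rho> \<rho>') (simp_all add: up_ren_comp)

lemma up_psubst_up_ren: "up_psubst \<tau> \<circ> up_ren \<rho> = up_psubst (\<tau> \<circ> \<rho>)"
  by (rule ext) (simp add: up_psubst_def up_ren_def split: nat.split)

lemma psubst_pren: "psubst \<tau> (pren \<rho> A) = psubst (\<tau> \<circ> \<rho>) A"
  by (induction A arbitrary: \<tau> \<rho>) (simp_all add: up_psubst_up_ren)

lemma pren_up_psubst: "pren (up_ren \<rho>) \<circ> up_psubst \<tau> = up_psubst (pren \<rho> \<circ> \<tau>)"
  by (rule ext) (simp add: up_psubst_def up_ren_def pren_pren comp_def split: nat.split)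

lemma pren_psubst: "pren \<rho> (psubst \<tau> A) = psubst (pren \<rho> \<circ> \<tau>) A"
  by (induction A arbitrary: \<tau> \<rho>) (simp_all add: pren_up_psubst)

lemma psubst_up_psubst:
  "psubst (up_psubst \<tau>) \<circ> up_psubst \<tau>' = up_psubst (psubst \<tau> \<circ> \<tau>')"
  by (rule ext)
    (simp add: up_psubst_def psubst_pren pren_psubst comp_def split: nat.split)

lemma psubst_psubst: "psubst \<tau> (psubst \<tau>' A) = psubst (psubst \<tau> \<circ> \<tau>') A"
  by (induction A arbitrary: \<tau> \<tau>') (simp_all add: psubst_up_psubst)

lemma up_psubst_PVar: "up_psubst PVar = PVar"
  by (rule ext) (simp add: up_psubst_def split: nat.split)

lemma psubst_PVar [simp]: "psubst PVar A = A"
  by (induction A) (simp_all add: up_psubst_PVar)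

lemma psubst_PVar_comp: "psubst (\<lambda>k. PVar (\<rho> k)) A = pren \<rho> A"
  using psubst_pren[of PVar \<rho> A] by (simp add: comp_def)

lemma tpsubst_PVar [simp]: "tpsubst PVar t = t"
  by (induction t) (simp_all add: up_psubst_PVar)

lemma tpsubst_tpsubst: "tpsubst \<tau> (tpsubst \<tau>' t) = tpsubst (psubst \<tau> \<circ> \<tau>') t"
  by (induction t arbitrary: \<tau> \<tau>') (simp_all add: psubst_psubst psubst_up_psubst)

lemma tren_tren: "tren \<rho> (tren \<rho>' t) = tren (\<rho> \<circ> \<rho>') t"
  by (induction t arbitrary: \<rho> \<rho>') (simp_all add: up_ren_comp)

lemma tpsubst_tren: "tpsubst \<tau> (tren \<rho> t) = tren \<rho> (tpsubst \<tau> t)"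
  by (induction t arbitrary: \<tau> \<rho>) simp_all

lemma up_tsubst_o_up_ren: "up_tsubst \<sigma> \<circ> up_ren \<rho> = up_tsubst (\<sigma> \<circ> \<rho>)"
  by (rule ext) (simp add: up_tsubst_def up_ren_def split: nat.split)

lemma tsubst_tren: "tsubst \<sigma> (tren \<rho> t) = tsubst (\<sigma> \<circ> \<rho>) t"
proof (induction t arbitrary: \<sigma> \<rho>)
  case (TLam t)
  then show ?case by (simp add: comp_def)
qed (simp_all add: up_tsubst_o_up_ren)

lemma tren_up_tsubst: "tren (up_ren \<rho>) \<circ> up_tsubst \<sigma> = up_tsubst (tren \<rho> \<circ> \<sigma>)"
  by (rule ext) (simp add: up_tsubst_def up_ren_def tren_tren comp_def split: nat.split)

lemma tren_tsubst: "tren \<rho> (tsubst \<sigma> t) = tsubst (tren \<rho> \<circ> \<sigma>) t"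
proof (induction t arbitrary: \<sigma> \<rho>)
  case (TLam t)
  then show ?case by (simp add: comp_def tpsubst_tren)
qed (simp_all add: tren_up_tsubst)

lemma tpsubst_up_tsubst: "tpsubst \<tau> \<circ> up_tsubst \<sigma> = up_tsubst (tpsubst \<tau> \<circ> \<sigma>)"
  by (rule ext) (simp add: up_tsubst_def tpsubst_tren split: nat.split)

lemma tpsubst_tsubst: "tpsubst \<tau> (tsubst \<sigma> t) = tsubst (tpsubst \<tau> \<circ> \<sigma>) (tpsubst \<tau> t)"
proof (induction t arbitrary: \<tau> \<sigma>)
  case (TLam t)
  \<comment> \<open>Under \<open>TLam\<close> the environment has been shifted past the new binder.
    Shifted terms do not mention index 0, so the lifted \<tau> acts on them as \<tau> followed by
    the shift.\<close>
  have "psubst (up_psubst \<tau>) \<circ> (\<lambda>k. PVar (Suc k)) = psubst (\<lambda>k. PVar (Suc k)) \<circ> \<tau>"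
    by (rule ext) (simp add: up_psubst_def psubst_PVar_comp)
  with TLam show ?case by (simp add: comp_def tpsubst_tpsubst)
qed (simp_all add: tpsubst_up_tsubst)

lemma tsubst_up_tsubst: "tsubst (up_tsubst \<sigma>) \<circ> up_tsubst \<sigma>' = up_tsubst (tsubst \<sigma> \<circ> \<sigma>')"
  by (rule ext)
    (simp add: up_tsubst_def tsubst_tren tren_tsubst comp_def split: nat.split)

lemma tsubst_tsubst: "tsubst \<sigma> (tsubst \<sigma>' t) = tsubst (tsubst \<sigma> \<circ> \<sigma>') t"
proof (induction t arbitrary: \<sigma> \<sigma>')
  case (TLam t)
  then show ?case by (simp add: comp_def tpsubst_tsubst)
qed (simp_all add: tsubst_up_tsubst)

lemma up_tsubst_Var: "up_tsubst Var = Var"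
  by (rule ext) (simp add: up_tsubst_def split: nat.split)

lemma tsubst_Var [simp]: "tsubst Var t = t"
  by (induction t) (simp_all add: up_tsubst_Var)

text \<open>Contracting a redex whose body carries a lifted environment just prepends the argument
  to that environment. With its variants for two variables and for types, this supplies the
  equations on bodies that the validity lemmas for binders ask for.\<close>

lemma subst1_tsubst_up: "subst1 u (tsubst (up_tsubst \<sigma>) t) = tsubst (case_nat u \<sigma>) t"
proof -
  have "tsubst (case_nat u Var) \<circ> up_tsubst \<sigma> = case_nat u \<sigma>"
    by (rule ext) (simp add: up_tsubst_def tsubst_tren case_nat_o_Suc split: nat.split)
  then show ?thesis by (simp add: subst1_def tsubst_tsubst)
qed

lemma subst2_tsubst_up:
  "subst2 u v (tsubst (up_tsubst (up_tsubst \<sigma>)) t) = tsubst (case_nat v (case_nat u \<sigma>)) t"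
proof -
  have "tsubst (case_nat v (case_nat u Var)) \<circ> up_tsubst (up_tsubst \<sigma>)
      = case_nat v (case_nat u \<sigma>)"
    by (rule ext)
      (simp add: up_tsubst_def tsubst_tren tren_tren comp_def split: nat.split)
  then show ?thesis by (simp add: subst2_def tsubst_tsubst)
qed

text \<open>The instantiation cancels the shift of \<sigma>, so the type argument enters through the
  valuation alone and leaves the environment as it was.\<close>

lemma tpsubst1_tsubst_up:
  "tpsubst1 A (tsubst (\<lambda>n. tpsubst (\<lambda>k. PVar (Suc k)) (\<sigma> n)) (tpsubst (up_psubst \<tau>) t))
    = tsubst \<sigma> (tpsubst (case_nat A \<tau>) t)"
proof -
  have "psubst (case_nat A PVar) \<circ> up_psubst \<tau> = case_nat A \<tau>"
    by (rule ext) (simp add: up_psubst_def psubst_pren case_nat_o_Suc split: nat.split)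
  then show ?thesis
    by (simp add: tpsubst1_def tpsubst_tsubst tpsubst_tpsubst comp_def)
qed

section \<open>Conversion\<close>

lemma conv_red: "s \<leadsto> t \<Longrightarrow> s \<simeq> t"
  by (rule r_into_equivclp)

lemma conv_cong:
  assumes "\<And>s t. s \<leadsto> t \<Longrightarrow> F s \<leadsto> F t" and "s \<simeq> t"
  shows "F s \<simeq> F t"
  using assms(2)
  by (induction rule: equivclp_induct) (auto intro: equivclp_into_equivclp assms(1))

lemma conv_cong2:
  assumes "\<And>s s' t. s \<leadsto> s' \<Longrightarrow> F s t \<leadsto> F s' t" and "\<And>s t t'. t \<leadsto> t' \<Longrightarrow> F s t \<leadsto> F s t'"
    and "s \<simeq> s'" and "t \<simeq> t'"
  shows "F s t \<simeq> F s' t'"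
  using conv_cong[of "\<lambda>s. F s t", OF assms(1,3)] conv_cong[of "F s'", OF assms(2,4)]
  by (rule equivclp_trans)

lemma conv_Sum: "s \<simeq> s' \<Longrightarrow> t \<simeq> t' \<Longrightarrow> s \<boxplus> t \<simeq> s' \<boxplus> t'"
  by (rule conv_cong2[of Sum]) (auto intro: red.intros)

lemma conv_Scal: "s \<simeq> s' \<Longrightarrow> a \<bullet>\<^sub>s s \<simeq> a \<bullet>\<^sub>s s'"
  by (rule conv_cong) (auto intro: red.intros)

text \<open>For eliminators, congruence is recorded in the principal position only: the other
  arguments depend on the environment and vary up to a candidate instead of conversion.\<close>

lemma conv_OneE: "s \<simeq> s' \<Longrightarrow> OneE s t \<simeq> OneE s' t"
  by (rule conv_cong) (auto intro: red.intros)

lemma conv_App: "s \<simeq> s' \<Longrightarrow> App s t \<simeq> App s' t"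
  by (rule conv_cong) (auto intro: red.intros)

lemma conv_TensorE: "s \<simeq> s' \<Longrightarrow> TensorE s A B t \<simeq> TensorE s' A B t"
  by (rule conv_cong) (auto intro: red.intros)

lemma conv_PlusE: "s \<simeq> s' \<Longrightarrow> PlusE s A t B u \<simeq> PlusE s' A t B u"
  by (rule conv_cong) (auto intro: red.intros)

lemma conv_WithE1: "s \<simeq> s' \<Longrightarrow> WithE1 s A t \<simeq> WithE1 s' A t"
  by (rule conv_cong) (auto intro: red.intros)

lemma conv_WithE2: "s \<simeq> s' \<Longrightarrow> WithE2 s A t \<simeq> WithE2 s' A t"
  by (rule conv_cong) (auto intro: red.intros)

lemma conv_Pair: "s \<simeq> s' \<Longrightarrow> t \<simeq> t' \<Longrightarrow> Pair s t \<simeq> Pair s' t'"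
  by (rule conv_cong2[of Pair]) (auto intro: red.intros)

lemma conv_TApp: "s \<simeq> s' \<Longrightarrow> TApp s A \<simeq> TApp s' A"
  by (rule conv_cong) (auto intro: red.intros)

section \<open>Candidates\<close>

type_synonym 's per = "'s trm \<Rightarrow> 's trm \<Rightarrow> bool"

text \<open>A zero element must not be required: \<open>Zero\<close> is interpreted by the empty relation.\<close>

locale cand =
  fixes E :: "'s::semiring per"
  assumes sym: "E s t \<Longrightarrow> E t s"
    and trans: "E s t \<Longrightarrow> E t u \<Longrightarrow> E s u"
    and conv_left: "s \<simeq> s' \<Longrightarrow> E s' t \<Longrightarrow> E s t"
    and sum: "E s s' \<Longrightarrow> E t t' \<Longrightarrow> E (s \<boxplus> t) (s' \<boxplus> t')"
    and scal: "E s s' \<Longrightarrow> E (a \<bullet>\<^sub>s s) (a \<bullet>\<^sub>s s')"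
    and sum_comm: "E s s \<Longrightarrow> E t t \<Longrightarrow> E (s \<boxplus> t) (t \<boxplus> s)"
    and sum_assoc: "E s s \<Longrightarrow> E t t \<Longrightarrow> E u u \<Longrightarrow> E (s \<boxplus> t \<boxplus> u) (s \<boxplus> (t \<boxplus> u))"
    and scal_sum: "E s s \<Longrightarrow> E t t \<Longrightarrow> E (a \<bullet>\<^sub>s (s \<boxplus> t)) (a \<bullet>\<^sub>s s \<boxplus> a \<bullet>\<^sub>s t)"
    and add_scal: "E s s \<Longrightarrow> E ((a + b) \<bullet>\<^sub>s s) (a \<bullet>\<^sub>s s \<boxplus> b \<bullet>\<^sub>s s)"
    and mult_scal: "E s s \<Longrightarrow> E ((a * b) \<bullet>\<^sub>s s) (a \<bullet>\<^sub>s (b \<bullet>\<^sub>s s))"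

text \<open>Multiplication by a central scalar counts as a binary operation that ignores its second
  argument, so that sums and scalars are treated at once.\<close>

inductive lin_op :: "('s::semiring trm \<Rightarrow> 's trm \<Rightarrow> 's trm) \<Rightarrow> bool" where
  lin_op_Sum: "lin_op Sum"
| lin_op_Scal: "(\<And>b. a * b = b * a) \<Longrightarrow> lin_op (\<lambda>u v. a \<bullet>\<^sub>s u)"

lemma conv_op: "lin_op \<omega> \<Longrightarrow> s \<simeq> s' \<Longrightarrow> t \<simeq> t' \<Longrightarrow> \<omega> s t \<simeq> \<omega> s' t'"
  by (erule lin_op.cases) (auto intro: conv_Sum conv_Scal)

lemma op_Pair: "lin_op \<omega> \<Longrightarrow> \<omega> (Pair s t) (Pair s' t') \<simeq> Pair (\<omega> s s') (\<omega> t t')"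
  by (erule lin_op.cases) (auto intro: red.intros)

context cand
begin

lemma refl_left: "E s t \<Longrightarrow> E s s"
  by (blast intro: sym trans)

lemma refl_right: "E s t \<Longrightarrow> E t t"
  by (blast intro: sym trans)

lemma conv: "s \<simeq> s' \<Longrightarrow> t \<simeq> t' \<Longrightarrow> E s' t' \<Longrightarrow> E s t"
  by (blast intro: sym conv_left)

lemma conv_right: "E s t' \<Longrightarrow> t \<simeq> t' \<Longrightarrow> E s t"
  by (rule conv[OF equivclp_refl])

lemma op_closed: "lin_op \<omega> \<Longrightarrow> E s s' \<Longrightarrow> E t t' \<Longrightarrow> E (\<omega> s t) (\<omega> s' t')"
  by (erule lin_op.cases) (auto intro: sum scal)

text \<open>The medial law of commutative semigroups, obtained by reassociating until the two middle
  summands are adjacent. It is what makes a pointwise sum of additive maps additive.\<close>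

lemma sum_interchange:
  assumes "E s s" "E t t" "E u u" "E v v"
  shows "E ((s \<boxplus> t) \<boxplus> (u \<boxplus> v)) ((s \<boxplus> u) \<boxplus> (t \<boxplus> v))"
proof -
  have "E ((s \<boxplus> t) \<boxplus> (u \<boxplus> v)) (s \<boxplus> (t \<boxplus> (u \<boxplus> v)))"
    using assms by (intro sum_assoc sum)
  moreover have "E (s \<boxplus> (t \<boxplus> (u \<boxplus> v))) (s \<boxplus> ((t \<boxplus> u) \<boxplus> v))"
    using assms by (intro sum sym[OF sum_assoc])
  moreover have "E (s \<boxplus> ((t \<boxplus> u) \<boxplus> v)) (s \<boxplus> ((u \<boxplus> t) \<boxplus> v))"
    using assms by (intro sum sum_comm)
  moreover have "E (s \<boxplus> ((u \<boxplus> t) \<boxplus> v)) (s \<boxplus> (u \<boxplus> (t \<boxplus> v)))"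
    using assms by (intro sum sum_assoc)
  moreover have "E (s \<boxplus> (u \<boxplus> (t \<boxplus> v))) ((s \<boxplus> u) \<boxplus> (t \<boxplus> v))"
    using assms by (intro sym[OF sum_assoc] sum)
  ultimately show ?thesis by (meson trans)
qed

lemma op_sum:
  assumes "lin_op \<omega>" "E s s" "E t t" "E u u" "E v v"
  shows "E (\<omega> s t \<boxplus> \<omega> u v) (\<omega> (s \<boxplus> u) (t \<boxplus> v))"
  using assms by cases (auto intro: sum_interchange sym[OF scal_sum])

lemma op_scal:
  assumes "lin_op \<omega>" "E s s" "E t t"
  shows "E (a \<bullet>\<^sub>s \<omega> s t) (\<omega> (a \<bullet>\<^sub>s s) (a \<bullet>\<^sub>s t))"
  using assms(1)
proof cases
  case lin_op_Sum
  then show ?thesis using assms by (simp add: scal_sum)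
next
  case (lin_op_Scal b)
  \<comment> \<open>The two scalars are exchanged inside the semiring. This is the step that
    exploits the centrality of \<open>b\<close>; the scalar \<open>a\<close> is arbitrary.\<close>
  have "E (a \<bullet>\<^sub>s (b \<bullet>\<^sub>s s)) ((b * a) \<bullet>\<^sub>s s)"
    using sym[OF mult_scal[of s a b]] assms(2) lin_op_Scal(2)[of a] by simp
  from trans[OF this mult_scal[OF assms(2)]] show ?thesis using lin_op_Scal by simp
qed

lemma op_interchange:
  assumes "lin_op \<omega>" "lin_op \<omega>'" "E s s" "E t t" "E u u" "E v v"
  shows "E (\<omega>' (\<omega> s t) (\<omega> u v)) (\<omega> (\<omega>' s u) (\<omega>' t v))"
  using assms(2) by cases (use assms in \<open>auto intro: op_sum op_scal\<close>)

end

section \<open>Candidates from observations and from generators\<close>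

definition pull ::
  "('s::semiring trm \<Rightarrow> bool) \<Rightarrow> 'i set \<Rightarrow> ('i \<Rightarrow> 's trm \<Rightarrow> 's trm) \<Rightarrow> ('i \<Rightarrow> 's per) \<Rightarrow> 's per" where
  "pull D I f E s t \<longleftrightarrow> D s \<and> D t \<and> (\<forall>i\<in>I. E i (f i s) (f i t))"

text \<open>\<open>pull\<close> relates terms of \<open>D\<close> that no observation
  \<open>f i\<close> separates. On \<open>D\<close> the observations are homomorphisms up to
  conversion, so each law follows by pushing \<open>f i\<close> inside on both sides and using the
  same law of \<open>E i\<close>. In the applications the observations are eliminators: projections,
  application to a fixed argument, instantiation at a fixed type.\<close>

lemma cand_pull:
  assumes D_conv: "\<And>s t. s \<simeq> t \<Longrightarrow> D t \<Longrightarrow> D s"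
    and D_sum: "\<And>s t. D s \<Longrightarrow> D t \<Longrightarrow> D (s \<boxplus> t)"
    and D_scal: "\<And>a s. D s \<Longrightarrow> D (a \<bullet>\<^sub>s s)"
    and E: "\<And>i. i \<in> I \<Longrightarrow> cand (E i)"
    and f_conv: "\<And>i s t. i \<in> I \<Longrightarrow> s \<simeq> t \<Longrightarrow> f i s \<simeq> f i t"
    and f_sum: "\<And>i s t. i \<in> I \<Longrightarrow> D s \<Longrightarrow> D t \<Longrightarrow> f i (s \<boxplus> t) \<simeq> f i s \<boxplus> f i t"
    and f_scal: "\<And>i a s. i \<in> I \<Longrightarrow> D s \<Longrightarrow> f i (a \<bullet>\<^sub>s s) \<simeq> a \<bullet>\<^sub>s f i s"
  shows "cand (pull D I f E)"
proof -
  have sum': "f i (s \<boxplus> t) \<simeq> s' \<boxplus> t'"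
    if "i \<in> I" "D s" "D t" "f i s \<simeq> s'" "f i t \<simeq> t'" for i s t s' t'
    by (rule equivclp_trans[OF f_sum[OF that(1-3)] conv_Sum[OF that(4,5)]])
  have scal': "f i (a \<bullet>\<^sub>s s) \<simeq> a \<bullet>\<^sub>s s'" if "i \<in> I" "D s" "f i s \<simeq> s'" for i a s s'
    by (rule equivclp_trans[OF f_scal[OF that(1,2)] conv_Scal[OF that(3)]])
  note rules = sum' scal' D_sum D_scal equivclp_refl
  have pullD: "D s" "D t" "\<And>i. i \<in> I \<Longrightarrow> E i (f i s) (f i t)"
    if "pull D I f E s t" for s t
    using that by (auto simp: pull_def)
  have pullI: "pull D I f E s t" if "D s" "D t" "\<And>i. i \<in> I \<Longrightarrow> E i (f i s) (f i t)" for s t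
    using that by (auto simp: pull_def)
  show ?thesis
  proof
    fix s t
    assume *: "pull D I f E s t"
    show "pull D I f E t s"
    proof (rule pullI)
      fix i assume i: "i \<in> I"
      show "E i (f i t) (f i s)" by (rule cand.sym[OF E[OF i] pullD(3)[OF * i]])
    qed (rule pullD[OF *])+
  next
    fix s t u
    assume *: "pull D I f E s t" "pull D I f E t u"
    show "pull D I f E s u"
    proof (rule pullI)
      fix i assume i: "i \<in> I"
      show "E i (f i s) (f i u)"
        by (rule cand.trans[OF E[OF i] pullD(3)[OF *(1) i] pullD(3)[OF *(2) i]])
    qed (rule pullD[OF *(1)] pullD[OF *(2)])+
  next
    fix s s' t
    assume *: "s \<simeq> s'" "pull D I f E s' t"
    show "pull D I f E s t"
    proof (rule pullI)
      show "D s" by (rule D_conv[OF *(1) pullD(1)[OF *(2)]])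
      fix i assume i: "i \<in> I"
      show "E i (f i s) (f i t)"
        by (rule cand.conv_left[OF E[OF i] f_conv[OF i *(1)] pullD(3)[OF *(2) i]])
    qed (rule pullD[OF *(2)])
  next
    fix s s' t t'
    assume *: "pull D I f E s s'" "pull D I f E t t'"
    show "pull D I f E (s \<boxplus> t) (s' \<boxplus> t')"
    proof (rule pullI)
      fix i assume i: "i \<in> I"
      show "E i (f i (s \<boxplus> t)) (f i (s' \<boxplus> t'))"
        by (rule cand.conv[OF E[OF i] _ _ cand.sum[OF E[OF i] pullD(3)[OF *(1) i] pullD(3)[OF *(2) i]]])
          (intro rules i *[THEN pullD(1)] *[THEN pullD(2)])+
    qed (intro rules *[THEN pullD(1)] *[THEN pullD(2)])+
  next
    fix s s' a
    assume *: "pull D I f E s s'"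
    show "pull D I f E (a \<bullet>\<^sub>s s) (a \<bullet>\<^sub>s s')"
    proof (rule pullI)
      fix i assume i: "i \<in> I"
      show "E i (f i (a \<bullet>\<^sub>s s)) (f i (a \<bullet>\<^sub>s s'))"
        by (rule cand.conv[OF E[OF i] _ _ cand.scal[where a = a, OF E[OF i] pullD(3)[OF * i]]])
          (intro rules i *[THEN pullD(1)] *[THEN pullD(2)])+
    qed (intro rules *[THEN pullD(1)] *[THEN pullD(2)])+
  next
    fix s t
    assume *: "pull D I f E s s" "pull D I f E t t"
    show "pull D I f E (s \<boxplus> t) (t \<boxplus> s)"
    proof (rule pullI)
      fix i assume i: "i \<in> I"
      show "E i (f i (s \<boxplus> t)) (f i (t \<boxplus> s))"
        by (rule cand.conv[OF E[OF i] _ _ cand.sum_comm[OF E[OF i] pullD(3)[OF *(1) i] pullD(3)[OF *(2) i]]])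
          (intro rules i *[THEN pullD(1)] *[THEN pullD(2)])+
    qed (intro rules *[THEN pullD(1)] *[THEN pullD(2)])+
  next
    fix s t u
    assume *: "pull D I f E s s" "pull D I f E t t" "pull D I f E u u"
    show "pull D I f E (s \<boxplus> t \<boxplus> u) (s \<boxplus> (t \<boxplus> u))"
    proof (rule pullI)
      fix i assume i: "i \<in> I"
      show "E i (f i (s \<boxplus> t \<boxplus> u)) (f i (s \<boxplus> (t \<boxplus> u)))"
        by (rule cand.conv[OF E[OF i] _ _ cand.sum_assoc[OF E[OF i] pullD(3)[OF *(1) i]
              pullD(3)[OF *(2) i] pullD(3)[OF *(3) i]]])
          (intro rules i *[THEN pullD(1)] *[THEN pullD(2)])+
    qed (intro rules *[THEN pullD(1)] *[THEN pullD(2)])+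
  next
    fix s t a
    assume *: "pull D I f E s s" "pull D I f E t t"
    show "pull D I f E (a \<bullet>\<^sub>s (s \<boxplus> t)) (a \<bullet>\<^sub>s s \<boxplus> a \<bullet>\<^sub>s t)"
    proof (rule pullI)
      fix i assume i: "i \<in> I"
      show "E i (f i (a \<bullet>\<^sub>s (s \<boxplus> t))) (f i (a \<bullet>\<^sub>s s \<boxplus> a \<bullet>\<^sub>s t))"
        by (rule cand.conv[OF E[OF i] _ _ cand.scal_sum[where a = a, OF E[OF i] pullD(3)[OF *(1) i] pullD(3)[OF *(2) i]]])
          (intro rules i *[THEN pullD(1)] *[THEN pullD(2)])+
    qed (intro rules *[THEN pullD(1)] *[THEN pullD(2)])+
  next
    fix s a b
    assume *: "pull D I f E s s"
    show "pull D I f E ((a + b) \<bullet>\<^sub>s s) (a \<bullet>\<^sub>s s \<boxplus> b \<bullet>\<^sub>s s)"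
    proof (rule pullI)
      fix i assume i: "i \<in> I"
      show "E i (f i ((a + b) \<bullet>\<^sub>s s)) (f i (a \<bullet>\<^sub>s s \<boxplus> b \<bullet>\<^sub>s s))"
        by (rule cand.conv[OF E[OF i] _ _ cand.add_scal[where a = a and b = b, OF E[OF i] pullD(3)[OF * i]]])
          (intro rules i *[THEN pullD(1)] *[THEN pullD(2)])+
    qed (intro rules *[THEN pullD(1)] *[THEN pullD(2)])+
  next
    fix s a b
    assume *: "pull D I f E s s"
    show "pull D I f E ((a * b) \<bullet>\<^sub>s s) (a \<bullet>\<^sub>s (b \<bullet>\<^sub>s s))"
    proof (rule pullI)
      fix i assume i: "i \<in> I"
      show "E i (f i ((a * b) \<bullet>\<^sub>s s)) (f i (a \<bullet>\<^sub>s (b \<bullet>\<^sub>s s)))"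
        by (rule cand.conv[OF E[OF i] _ _ cand.mult_scal[where a = a and b = b, OF E[OF i] pullD(3)[OF * i]]])
          (intro rules i *[THEN pullD(1)] *[THEN pullD(2)])+
    qed (intro rules *[THEN pullD(1)] *[THEN pullD(2)])+
  qed
qed

text \<open>The least candidate containing \<open>G\<close>. A pair of \<open>G\<close> has two
  roles: it imposes an equation, and, by symmetry and transitivity, it puts both of its ends into
  the domain as generators.\<close>

inductive free :: "'s::semiring per \<Rightarrow> 's per" for G where
  gen: "G s t \<Longrightarrow> free G s t"
| free_sym: "free G s t \<Longrightarrow> free G t s"
| free_trans: "free G s t \<Longrightarrow> free G t u \<Longrightarrow> free G s u"
| free_conv: "s \<simeq> s' \<Longrightarrow> free G s' t \<Longrightarrow> free G s t"
| free_sum: "free G s s' \<Longrightarrow> free G t t' \<Longrightarrow> free G (s \<boxplus> t) (s' \<boxplus> t')"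
| free_scal: "free G s s' \<Longrightarrow> free G (a \<bullet>\<^sub>s s) (a \<bullet>\<^sub>s s')"
| free_sum_comm: "free G s s \<Longrightarrow> free G t t \<Longrightarrow> free G (s \<boxplus> t) (t \<boxplus> s)"
| free_sum_assoc:
    "free G s s \<Longrightarrow> free G t t \<Longrightarrow> free G u u \<Longrightarrow> free G (s \<boxplus> t \<boxplus> u) (s \<boxplus> (t \<boxplus> u))"
| free_scal_sum:
    "free G s s \<Longrightarrow> free G t t \<Longrightarrow> free G (a \<bullet>\<^sub>s (s \<boxplus> t)) (a \<bullet>\<^sub>s s \<boxplus> a \<bullet>\<^sub>s t)"
| free_add_scal: "free G s s \<Longrightarrow> free G ((a + b) \<bullet>\<^sub>s s) (a \<bullet>\<^sub>s s \<boxplus> b \<bullet>\<^sub>s s)"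
| free_mult_scal: "free G s s \<Longrightarrow> free G ((a * b) \<bullet>\<^sub>s s) (a \<bullet>\<^sub>s (b \<bullet>\<^sub>s s))"

lemma cand_free: "cand (free G)"
  by (rule cand.intro[OF free_sym free_trans free_conv free_sum free_scal free_sum_comm
    free_sum_assoc free_scal_sum free_add_scal free_mult_scal])

text \<open>In contrast to the observations of \<open>pull\<close>, a frame is linear on all terms.
  \<open>TensorE\<close> and \<open>PlusE\<close> are of this kind thanks to their commuting
  reductions, which is why free modules can be eliminated although their elements are not all
  introductions.\<close>

definition frame :: "('s::semiring trm \<Rightarrow> 's trm) \<Rightarrow> bool" where
  "frame F \<longleftrightarrow> (\<forall>s t. s \<simeq> t \<longrightarrow> F s \<simeq> F t) \<and> (\<forall>s t. F (s \<boxplus> t) \<simeq> F s \<boxplus> F t) \<and>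
    (\<forall>a s. F (a \<bullet>\<^sub>s s) \<simeq> a \<bullet>\<^sub>s F s)"

lemma frame_sum: "frame F \<Longrightarrow> F s \<simeq> s' \<Longrightarrow> F t \<simeq> t' \<Longrightarrow> F (s \<boxplus> t) \<simeq> s' \<boxplus> t'"
  by (rule equivclp_trans[OF _ conv_Sum]) (simp_all add: frame_def)

lemma frame_scal: "frame F \<Longrightarrow> F s \<simeq> s' \<Longrightarrow> F (a \<bullet>\<^sub>s s) \<simeq> a \<bullet>\<^sub>s s'"
  by (rule equivclp_trans[OF _ conv_Scal]) (simp_all add: frame_def)

lemma frame_op: "frame F \<Longrightarrow> lin_op \<omega> \<Longrightarrow> F (\<omega> s t) \<simeq> \<omega> (F s) (F t)"
  by (erule lin_op.cases) (auto simp: frame_def)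

text \<open>The universal property of the free module: every clause of \<open>free\<close> is
  matched by a law of \<open>C\<close> once the frame has been pushed inside, so only the generators
  have to be checked.\<close>

lemma free_elim:
  assumes C: "cand C" and F: "frame F" and G: "\<And>s t. G s t \<Longrightarrow> C (F s) (F t)"
    and "free G s t"
  shows "C (F s) (F t)"
proof -
  interpret cand C by (rule C)
  note rules = frame_sum[OF F] frame_scal[OF F] equivclp_refl
  from assms(4) show ?thesis
  proof induction
    case (free_conv s s' t)
    have "F s \<simeq> F s'" using F free_conv(1) by (simp add: frame_def)
    then show ?case using free_conv(3) by (rule conv_left)
  next
    case (free_sum s s' t t')
    show ?case by (rule conv[OF _ _ sum[OF free_sum.IH]]) (intro rules)+
  next
    case (free_scal s s' a)
    show ?case by (rule conv[OF _ _ scal[where a = a, OF free_scal.IH]]) (intro rules)+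
  next
    case (free_sum_comm s t)
    show ?case by (rule conv[OF _ _ sum_comm[OF free_sum_comm.IH]]) (intro rules)+
  next
    case (free_sum_assoc s t u)
    show ?case by (rule conv[OF _ _ sum_assoc[OF free_sum_assoc.IH]]) (intro rules)+
  next
    case (free_scal_sum s t a)
    show ?case by (rule conv[OF _ _ scal_sum[where a = a, OF free_scal_sum.IH]]) (intro rules)+
  next
    case (free_add_scal s a b)
    show ?case by (rule conv[OF _ _ add_scal[where a = a and b = b, OF free_add_scal.IH]]) (intro rules)+
  next
    case (free_mult_scal s a b)
    show ?case by (rule conv[OF _ _ mult_scal[where a = a and b = b, OF free_mult_scal.IH]]) (intro rules)+
  next
    case (free_sym s t)
    from free_sym(2) show ?case by (rule sym)
  next
    case (free_trans s t u)
    from free_trans(3,4) show ?case by (rule trans)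
  qed (rule G)
qed

text \<open>The laws only rearrange terms already in the domain, so closure under conversion and the
  operations suffices. Both ends are followed at once because a reflexive pair may arise by
  transitivity from pairs that are not reflexive.\<close>

lemma free_dom:
  assumes "free G s t"
    and "\<And>s t. G s t \<Longrightarrow> Q s \<and> Q t"
    and "\<And>s t. s \<simeq> t \<Longrightarrow> Q t \<Longrightarrow> Q s"
    and "\<And>s t. Q s \<Longrightarrow> Q t \<Longrightarrow> Q (s \<boxplus> t)"
    and "\<And>a s. Q s \<Longrightarrow> Q (a \<bullet>\<^sub>s s)"
  shows "Q s \<and> Q t"
  using assms(1)
proof induction
  case (free_conv s s' t)
  then show ?case using assms(3)[OF free_conv(1)] by simp
qed (simp_all add: assms(2,4,5))

section \<open>Interpretation of the connectives\<close>

text \<open>The semiring as a module over itself. Transitivity does not require scalars to be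
  unique: if the middle term converts to two \<open>Star\<close> terms, these are convertible
  through it.\<close>

definition one_per :: "'s::semiring per" where
  "one_per s t \<longleftrightarrow> (\<exists>a. s \<simeq> Star a \<and> t \<simeq> Star a)"

lemma conv_Star_sum: "s \<simeq> Star a \<Longrightarrow> t \<simeq> Star b \<Longrightarrow> s \<boxplus> t \<simeq> Star (a + b)"
  by (rule equivclp_trans[OF conv_Sum conv_red[OF R_Sum_Star]])

lemma conv_Star_scal: "s \<simeq> Star b \<Longrightarrow> a \<bullet>\<^sub>s s \<simeq> Star (a * b)"
  by (rule equivclp_trans[OF conv_Scal conv_red[OF R_Scal_Star]])

lemma cand_one: "cand (one_per :: 's::semiring per)"
proof
  note rules = conv_Star_sum conv_Star_scal
  fix s t u s' t' :: "'s trm" and a b :: 's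
  show "one_per s t \<Longrightarrow> one_per t s"
    by (auto simp: one_per_def)
  show "one_per s t \<Longrightarrow> one_per t u \<Longrightarrow> one_per s u"
    unfolding one_per_def by (meson equivclp_trans equivclp_sym)
  show "s \<simeq> s' \<Longrightarrow> one_per s' t \<Longrightarrow> one_per s t"
    unfolding one_per_def by (meson equivclp_trans)
  show "one_per s s' \<Longrightarrow> one_per t t' \<Longrightarrow> one_per (s \<boxplus> t) (s' \<boxplus> t')"
    unfolding one_per_def by (meson rules)
  show "one_per s s' \<Longrightarrow> one_per (a \<bullet>\<^sub>s s) (a \<bullet>\<^sub>s s')"
    unfolding one_per_def by (meson rules)
  {
    assume "one_per s s" then obtain c where s: "s \<simeq> Star c"
      by (auto simp: one_per_def)
    show "one_per ((a + b) \<bullet>\<^sub>s s) (a \<bullet>\<^sub>s s \<boxplus> b \<bullet>\<^sub>s s)"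
      unfolding one_per_def using rules(2)[OF s, of "a + b"] rules(1)[OF rules(2) rules(2), OF s s, of a b]
      by (auto simp only: distrib_right)
    show "one_per ((a * b) \<bullet>\<^sub>s s) (a \<bullet>\<^sub>s (b \<bullet>\<^sub>s s))"
      unfolding one_per_def using rules(2)[OF s, of "a * b"] rules(2)[OF rules(2), OF s, of a b]
      by (auto simp only: mult.assoc)
    assume "one_per t t" then obtain d where t: "t \<simeq> Star d"
      by (auto simp: one_per_def)
    show "one_per (s \<boxplus> t) (t \<boxplus> s)"
      unfolding one_per_def using rules(1)[OF s t] rules(1)[OF t s] by (auto simp only: add.commute)
    show "one_per (a \<bullet>\<^sub>s (s \<boxplus> t)) (a \<bullet>\<^sub>s s \<boxplus> a \<bullet>\<^sub>s t)"
      unfolding one_per_def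
      using rules(2)[OF rules(1), OF s t, of a] rules(1)[OF rules(2) rules(2), OF s t, of a a]
      by (auto simp only: distrib_left)
    assume "one_per u u" then obtain e where u: "u \<simeq> Star e"
      by (auto simp: one_per_def)
    show "one_per (s \<boxplus> t \<boxplus> u) (s \<boxplus> (t \<boxplus> u))"
      unfolding one_per_def
      using rules(1)[OF rules(1), OF s t u] rules(1)[OF s rules(1), OF t u]
      by (auto simp only: add.assoc)
  }
qed

definition top_per :: "'s::semiring per" where
  "top_per = pull (\<lambda>s. s \<simeq> Unit) ({} :: unit set) (\<lambda>_ s. s) (\<lambda>_ _ _. False)"

lemma conv_Unit_sum: "s \<simeq> Unit \<Longrightarrow> t \<simeq> Unit \<Longrightarrow> s \<boxplus> t \<simeq> Unit"
  by (rule equivclp_trans[OF conv_Sum conv_red[OF R_Sum_Unit]])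

lemma conv_Unit_scal: "s \<simeq> Unit \<Longrightarrow> a \<bullet>\<^sub>s s \<simeq> Unit"
  by (rule equivclp_trans[OF conv_Scal conv_red[OF R_Scal_Unit]])

lemma cand_top: "cand top_per"
  unfolding top_per_def
  by (rule cand_pull) (simp_all add: equivclp_trans conv_Unit_sum conv_Unit_scal)

lemma cand_empty: "cand (\<lambda>_ _. False)"
  by unfold_locales simp_all

section \<open>Additive conjunction\<close>

lemma subst1_Var_0 [simp]: "subst1 u (Var 0) = u"
  by (simp add: subst1_def)

lemma conv_fst: "s \<simeq> Pair p q \<Longrightarrow> WithE1 s A t \<simeq> subst1 p t"
  by (rule equivclp_trans[OF conv_WithE1 conv_red[OF R_With1]])

lemma conv_snd: "s \<simeq> Pair p q \<Longrightarrow> WithE2 s A t \<simeq> subst1 q t"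
  by (rule equivclp_trans[OF conv_WithE2 conv_red[OF R_With2]])

lemma conv_Pair_sum: "s \<simeq> Pair p q \<Longrightarrow> t \<simeq> Pair p' q' \<Longrightarrow> s \<boxplus> t \<simeq> Pair (p \<boxplus> p') (q \<boxplus> q')"
  by (rule equivclp_trans[OF conv_Sum conv_red[OF R_Sum_Pair]])

lemma conv_Pair_scal: "s \<simeq> Pair p q \<Longrightarrow> a \<bullet>\<^sub>s s \<simeq> Pair (a \<bullet>\<^sub>s p) (a \<bullet>\<^sub>s q)"
  by (rule equivclp_trans[OF conv_Scal conv_red[OF R_Scal_Pair]])

lemma conv_Pair_op:
  "lin_op \<omega> \<Longrightarrow> s \<simeq> Pair p q \<Longrightarrow> t \<simeq> Pair p' q' \<Longrightarrow> \<omega> s t \<simeq> Pair (\<omega> p p') (\<omega> q q')"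
  by (rule equivclp_trans[OF conv_op op_Pair])

text \<open>The annotation \<open>One\<close> is a dummy: the projection rules fire under any
  annotation, and candidates are untyped.\<close>

definition proj :: "bool \<Rightarrow> 's::semiring trm \<Rightarrow> 's trm" where
  "proj b s = (if b then WithE1 s One (Var 0) else WithE2 s One (Var 0))"

lemma conv_proj: "s \<simeq> t \<Longrightarrow> proj b s \<simeq> proj b t"
  by (simp add: proj_def conv_WithE1 conv_WithE2)

lemma proj_Pair: "s \<simeq> Pair p q \<Longrightarrow> proj b s \<simeq> (if b then p else q)"
  using conv_fst[of s p q One "Var 0"] conv_snd[of s p q One "Var 0"] by (simp add: proj_def)

definition with_per :: "'s::semiring per \<Rightarrow> 's per \<Rightarrow> 's per" where
  "with_per EA EB = pull (\<lambda>s. \<exists>p q. s \<simeq> Pair p q) UNIV proj (\<lambda>b. if b then EA else EB)"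

lemma cand_with:
  fixes EA EB :: "'s::semiring per"
  assumes "cand EA" "cand EB"
  shows "cand (with_per EA EB)"
  unfolding with_per_def
proof (rule cand_pull)
  fix b and s t :: "'s trm" assume "\<exists>p q. s \<simeq> Pair p q" "\<exists>p q. t \<simeq> Pair p q"
  then obtain p q p' q' where *: "s \<simeq> Pair p q" "t \<simeq> Pair p' q'" by blast
  have "proj b (s \<boxplus> t) \<simeq> (if b then p else q) \<boxplus> (if b then p' else q')"
    using proj_Pair[OF conv_Pair_sum[OF *], of b] by (simp split: if_splits)
  also have "\<dots> \<simeq> proj b s \<boxplus> proj b t"
    by (rule equivclp_sym[OF conv_Sum[OF proj_Pair[OF *(1)] proj_Pair[OF *(2)]]])
  finally show "proj b (s \<boxplus> t) \<simeq> proj b s \<boxplus> proj b t" .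
next
  fix b a and s :: "'s trm" assume "\<exists>p q. s \<simeq> Pair p q"
  then obtain p q where *: "s \<simeq> Pair p q" by blast
  have "proj b (a \<bullet>\<^sub>s s) \<simeq> a \<bullet>\<^sub>s (if b then p else q)"
    using proj_Pair[OF conv_Pair_scal[OF *, of a], of b] by (simp split: if_splits)
  also have "\<dots> \<simeq> a \<bullet>\<^sub>s proj b s"
    by (rule equivclp_sym[OF conv_Scal[OF proj_Pair[OF *]]])
  finally show "proj b (a \<bullet>\<^sub>s s) \<simeq> a \<bullet>\<^sub>s proj b s" .
next
  show "\<exists>p q. s \<simeq> Pair p q" if "s \<simeq> t" "\<exists>p q. t \<simeq> Pair p q" for s t :: "'s trm"
    using that by (meson equivclp_trans)
  show "\<exists>p q. s \<boxplus> t \<simeq> Pair p q" if "\<exists>p q. s \<simeq> Pair p q" "\<exists>p q. t \<simeq> Pair p q" for s t :: "'s trm"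
    using that by (meson conv_Pair_sum)
  show "\<exists>p q. a \<bullet>\<^sub>s s \<simeq> Pair p q" if "\<exists>p q. s \<simeq> Pair p q" for a and s :: "'s trm"
    using that by (meson conv_Pair_scal)
qed (simp_all add: assms conv_proj)

text \<open>Projections determine the components up to conversion, so any pair that a term converts
  to may serve as witness. The observational form yields the candidate laws, this form serves the
  validity lemmas.\<close>

lemma with_per_iff:
  assumes "cand EA" "cand EB"
  shows "with_per EA EB s t \<longleftrightarrow>
    (\<exists>p q p' q'. s \<simeq> Pair p q \<and> t \<simeq> Pair p' q' \<and> EA p p' \<and> EB q q')"
proof -
  have *: "(if b then EA else EB) (proj b s) (proj b t) \<longleftrightarrow>
      (if b then EA else EB) (if b then p else q) (if b then p' else q')"
    if "s \<simeq> Pair p q" "t \<simeq> Pair p' q'" for b p q p' q'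
  proof -
    interpret cand "if b then EA else EB" using assms by simp
    note c = proj_Pair[OF that(1), of b] proj_Pair[OF that(2), of b]
    show ?thesis by (rule iffI) (rule conv[OF c[THEN equivclp_sym]] conv[OF c]; assumption)+
  qed
  have "with_per EA EB s t \<longleftrightarrow> (\<exists>p q p' q'. s \<simeq> Pair p q \<and> t \<simeq> Pair p' q' \<and>
      (\<forall>b. (if b then EA else EB) (proj b s) (proj b t)))"
    by (simp add: with_per_def pull_def)
  also have "\<dots> \<longleftrightarrow> (\<exists>p q p' q'. s \<simeq> Pair p q \<and> t \<simeq> Pair p' q' \<and>
      (\<forall>b. (if b then EA else EB) (if b then p else q) (if b then p' else q')))"
    by (intro ex_cong1 conj_cong refl all_cong1) (rule *)
  finally show ?thesis by (simp only: all_bool_eq if_True if_False simp_thms)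
qed

section \<open>Linear implication\<close>

definition lin_fun :: "fml \<Rightarrow> 's::semiring per \<Rightarrow> 's per \<Rightarrow> 's trm \<Rightarrow> bool" where
  "lin_fun A EA EB f \<longleftrightarrow> (\<exists>t. f \<simeq> Lam A t) \<and>
    (\<forall>u v. EA u v \<longrightarrow> EB (App f u) (App f v)) \<and>
    (\<forall>\<omega> u v. lin_op \<omega> \<longrightarrow> EA u u \<longrightarrow> EA v v \<longrightarrow> EB (App f (\<omega> u v)) (\<omega> (App f u) (App f v)))"

text \<open>Extensional equality of linear maps. The domain fixes the annotation \<open>A\<close>
  because two abstractions add up by reduction only when their annotations coincide.\<close>

definition lolli_per :: "fml \<Rightarrow> 's::semiring per \<Rightarrow> 's per \<Rightarrow> 's per" where
  "lolli_per A EA EB = pull (lin_fun A EA EB) {u. EA u u} (\<lambda>u f. App f u) (\<lambda>_. EB)"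

lemma conv_beta: "f \<simeq> Lam A t \<Longrightarrow> App f u \<simeq> subst1 u t"
  by (rule equivclp_trans[OF conv_App conv_red[OF R_Lam]])

lemma conv_Lam_sum: "f \<simeq> Lam A t \<Longrightarrow> g \<simeq> Lam A t' \<Longrightarrow> f \<boxplus> g \<simeq> Lam A (t \<boxplus> t')"
  by (rule equivclp_trans[OF conv_Sum conv_red[OF R_Sum_Lam]])

lemma conv_Lam_scal: "f \<simeq> Lam A t \<Longrightarrow> a \<bullet>\<^sub>s f \<simeq> Lam A (a \<bullet>\<^sub>s t)"
  by (rule equivclp_trans[OF conv_Scal conv_red[OF R_Scal_Lam]])

text \<open>Application does not distribute over a sum of functions by itself: the sum is first
  moved under the common binder, then substitution acts on each summand.\<close>

lemma App_sum:
  assumes "lin_fun A EA EB f" "lin_fun A EA EB g"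
  shows "App (f \<boxplus> g) u \<simeq> App f u \<boxplus> App g u"
proof -
  from assms obtain t t' where *: "f \<simeq> Lam A t" "g \<simeq> Lam A t'"
    unfolding lin_fun_def by blast
  have "App (f \<boxplus> g) u \<simeq> subst1 u t \<boxplus> subst1 u t'"
    using conv_beta[OF conv_Lam_sum[OF *], of u] by (simp add: subst1_def)
  also have "\<dots> \<simeq> App f u \<boxplus> App g u"
    by (rule equivclp_sym[OF conv_Sum[OF conv_beta[OF *(1)] conv_beta[OF *(2)]]])
  finally show ?thesis .
qed

lemma App_scal:
  assumes "lin_fun A EA EB f"
  shows "App (a \<bullet>\<^sub>s f) u \<simeq> a \<bullet>\<^sub>s App f u"
proof -
  from assms obtain t where *: "f \<simeq> Lam A t"
    unfolding lin_fun_def by blast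
  have "App (a \<bullet>\<^sub>s f) u \<simeq> a \<bullet>\<^sub>s subst1 u t"
    using conv_beta[OF conv_Lam_scal[OF *, of a], of u] by (simp add: subst1_def)
  also have "\<dots> \<simeq> a \<bullet>\<^sub>s App f u"
    by (rule equivclp_sym[OF conv_Scal[OF conv_beta[OF *]]])
  finally show ?thesis .
qed

lemma App_op:
  "lin_op \<omega> \<Longrightarrow> lin_fun A EA EB f \<Longrightarrow> lin_fun A EA EB g \<Longrightarrow> App (\<omega> f g) u \<simeq> \<omega> (App f u) (App g u)"
  by (erule lin_op.cases) (auto simp: App_sum App_scal)

lemma lin_fun_conv:
  fixes EB :: "'s::semiring per"
  assumes "cand EB" "f \<simeq> g" "lin_fun A EA EB g"
  shows "lin_fun A EA EB f"
proof -
  interpret cand EB by fact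
  note c = conv_App[OF assms(2)]
  show ?thesis
    unfolding lin_fun_def
  proof (intro conjI allI impI)
    show "\<exists>t. f \<simeq> Lam A t"
      using assms unfolding lin_fun_def by (meson equivclp_trans)
    fix u v assume "EA u v"
    with assms(3) show "EB (App f u) (App f v)"
      by (intro conv[OF c c]) (simp add: lin_fun_def)
  next
    fix \<omega> :: "'s trm \<Rightarrow> 's trm \<Rightarrow> 's trm" and u v assume "lin_op \<omega>" "EA u u" "EA v v"
    with assms(3) show "EB (App f (\<omega> u v)) (\<omega> (App f u) (App f v))"
      by (intro conv[OF c conv_op[OF _ c c]]) (simp_all add: lin_fun_def)
  qed
qed

lemma lin_fun_sum:
  fixes EB :: "'s::semiring per"
  assumes "cand EB" "lin_fun A EA EB f" "lin_fun A EA EB g"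
  shows "lin_fun A EA EB (f \<boxplus> g)"
proof -
  interpret cand EB by fact
  note c = App_sum[OF assms(2,3)]
  have f: "EB (App f u) (App f v)" "EB (App g u) (App g v)" if "EA u v" for u v
    using assms that by (auto simp: lin_fun_def)
  show ?thesis
    unfolding lin_fun_def
  proof (intro conjI allI impI)
    show "\<exists>t. f \<boxplus> g \<simeq> Lam A t"
      using assms unfolding lin_fun_def by (meson conv_Lam_sum)
    fix u v assume "EA u v"
    then show "EB (App (f \<boxplus> g) u) (App (f \<boxplus> g) v)"
      by (intro conv[OF c c] sum f)
  next
    fix \<omega> :: "'s trm \<Rightarrow> 's trm \<Rightarrow> 's trm" and u v assume *: "lin_op \<omega>" "EA u u" "EA v v"
    then have "EB (App f (\<omega> u v)) (\<omega> (App f u) (App f v))"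
        "EB (App g (\<omega> u v)) (\<omega> (App g u) (App g v))"
      using assms by (auto simp: lin_fun_def)
    from trans[OF sum[OF this] op_sum[OF *(1) f(1) f(1) f(2) f(2), OF *(2,3,2,3)]] *(1)
    show "EB (App (f \<boxplus> g) (\<omega> u v)) (\<omega> (App (f \<boxplus> g) u) (App (f \<boxplus> g) v))"
      by (intro conv[OF c conv_op[OF _ c c]]) (simp_all add: f)
  qed
qed

text \<open>The factor \<open>a\<close> is arbitrary: it commutes with \<omega> because a scalar
  inside \<omega> is central. Linearity asked for central scalars only is thus stable under all
  scalars.\<close>

lemma lin_fun_scal:
  fixes EB :: "'s::semiring per"
  assumes "cand EB" "lin_fun A EA EB f"
  shows "lin_fun A EA EB (a \<bullet>\<^sub>s f)"
proof -
  interpret cand EB by fact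
  note c = App_scal[OF assms(2)]
  have f: "EB (App f u) (App f v)" if "EA u v" for u v
    using assms that by (auto simp: lin_fun_def)
  show ?thesis
    unfolding lin_fun_def
  proof (intro conjI allI impI)
    show "\<exists>t. a \<bullet>\<^sub>s f \<simeq> Lam A t"
      using assms unfolding lin_fun_def by (meson conv_Lam_scal)
    fix u v assume "EA u v"
    then show "EB (App (a \<bullet>\<^sub>s f) u) (App (a \<bullet>\<^sub>s f) v)"
      by (intro conv[OF c c] scal f)
  next
    fix \<omega> :: "'s trm \<Rightarrow> 's trm \<Rightarrow> 's trm" and u v assume *: "lin_op \<omega>" "EA u u" "EA v v"
    then have "EB (App f (\<omega> u v)) (\<omega> (App f u) (App f v))"
      using assms by (auto simp: lin_fun_def)
    from trans[OF scal[OF this] op_scal[OF *(1) f f, OF *(2,3)]] *(1)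
    show "EB (App (a \<bullet>\<^sub>s f) (\<omega> u v)) (\<omega> (App (a \<bullet>\<^sub>s f) u) (App (a \<bullet>\<^sub>s f) v))"
      by (intro conv[OF c conv_op[OF _ c c]]) (simp_all add: f)
  qed
qed

lemma cand_lolli: "cand EB \<Longrightarrow> cand (lolli_per A EA EB)"
  unfolding lolli_per_def
  by (rule cand_pull)
    (auto simp: conv_App App_sum App_scal lin_fun_sum lin_fun_scal dest: lin_fun_conv)

text \<open>The first clause gives congruence, the other two impose bilinearity. Only sums and
  central scalars are moved out: moving scalars \<open>a\<close> and \<open>b\<close> out of the two
  factors in either order identifies \<open>a * b\<close> and \<open>b * a\<close> as
  multipliers.\<close>

inductive tensor_gen :: "'s::semiring per \<Rightarrow> 's per \<Rightarrow> 's per" for EA EB where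
  tensor_base: "EA u u' \<Longrightarrow> EB v v' \<Longrightarrow> tensor_gen EA EB (Tens u v) (Tens u' v')"
| tensor_left: "lin_op \<omega> \<Longrightarrow> EA u u \<Longrightarrow> EA u' u' \<Longrightarrow> EB v v \<Longrightarrow>
    tensor_gen EA EB (Tens (\<omega> u u') v) (\<omega> (Tens u v) (Tens u' v))"
| tensor_right: "lin_op \<omega> \<Longrightarrow> EA u u \<Longrightarrow> EB v v \<Longrightarrow> EB v' v' \<Longrightarrow>
    tensor_gen EA EB (Tens u (\<omega> v v')) (\<omega> (Tens u v) (Tens u v'))"

inductive plus_gen :: "'s::semiring per \<Rightarrow> 's per \<Rightarrow> 's per" for EA EB where
  plus_inl: "EA u u' \<Longrightarrow> plus_gen EA EB (InL u) (InL u')"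
| plus_inr: "EB v v' \<Longrightarrow> plus_gen EA EB (InR v) (InR v')"
| plus_inl_op: "lin_op \<omega> \<Longrightarrow> EA u u \<Longrightarrow> EA u' u' \<Longrightarrow>
    plus_gen EA EB (InL (\<omega> u u')) (\<omega> (InL u) (InL u'))"
| plus_inr_op: "lin_op \<omega> \<Longrightarrow> EB v v \<Longrightarrow> EB v' v' \<Longrightarrow>
    plus_gen EA EB (InR (\<omega> v v')) (\<omega> (InR v) (InR v'))"

text \<open>The syntactic instance \<open>A\<close> and the candidate \<open>C\<close> chosen for the bound variable are unrelated.\<close>

definition all_per :: "(fml \<Rightarrow> 's::semiring per \<Rightarrow> 's per) \<Rightarrow> 's per" where
  "all_per EB = pull (\<lambda>s. \<exists>t. s \<simeq> TLam t) {(A, C). cand C} (\<lambda>(A, C) s. TApp s A) (\<lambda>(A, C). EB A C)"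

section \<open>Second-order quantification\<close>

lemma conv_TLam_beta: "s \<simeq> TLam t \<Longrightarrow> TApp s A \<simeq> tpsubst1 A t"
  by (rule equivclp_trans[OF conv_TApp conv_red[OF R_TLam]])

lemma conv_TLam_sum: "s \<simeq> TLam p \<Longrightarrow> t \<simeq> TLam q \<Longrightarrow> s \<boxplus> t \<simeq> TLam (p \<boxplus> q)"
  by (rule equivclp_trans[OF conv_Sum conv_red[OF R_Sum_TLam]])

lemma conv_TLam_scal: "s \<simeq> TLam p \<Longrightarrow> a \<bullet>\<^sub>s s \<simeq> TLam (a \<bullet>\<^sub>s p)"
  by (rule equivclp_trans[OF conv_Scal conv_red[OF R_Scal_TLam]])

lemma TApp_sum:
  assumes "\<exists>p. s \<simeq> TLam p" "\<exists>q. t \<simeq> TLam q"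
  shows "TApp (s \<boxplus> t) A \<simeq> TApp s A \<boxplus> TApp t A"
proof -
  from assms obtain p q where *: "s \<simeq> TLam p" "t \<simeq> TLam q" by blast
  have "TApp (s \<boxplus> t) A \<simeq> tpsubst1 A p \<boxplus> tpsubst1 A q"
    using conv_TLam_beta[OF conv_TLam_sum[OF *], of A] by (simp add: tpsubst1_def)
  also have "\<dots> \<simeq> TApp s A \<boxplus> TApp t A"
    by (rule equivclp_sym[OF conv_Sum[OF conv_TLam_beta[OF *(1)] conv_TLam_beta[OF *(2)]]])
  finally show ?thesis .
qed

lemma TApp_scal:
  assumes "\<exists>p. s \<simeq> TLam p"
  shows "TApp (a \<bullet>\<^sub>s s) A \<simeq> a \<bullet>\<^sub>s TApp s A"
proof -
  from assms obtain p where *: "s \<simeq> TLam p" by blast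
  have "TApp (a \<bullet>\<^sub>s s) A \<simeq> a \<bullet>\<^sub>s tpsubst1 A p"
    using conv_TLam_beta[OF conv_TLam_scal[OF *, of a], of A] by (simp add: tpsubst1_def)
  also have "\<dots> \<simeq> a \<bullet>\<^sub>s TApp s A"
    by (rule equivclp_sym[OF conv_Scal[OF conv_TLam_beta[OF *]]])
  finally show ?thesis .
qed

lemma TApp_op:
  "lin_op \<omega> \<Longrightarrow> \<exists>p. s \<simeq> TLam p \<Longrightarrow> \<exists>q. t \<simeq> TLam q \<Longrightarrow> TApp (\<omega> s t) A \<simeq> \<omega> (TApp s A) (TApp t A)"
  by (erule lin_op.cases) (simp_all only: TApp_sum TApp_scal)

lemma cand_all:
  fixes EB :: "fml \<Rightarrow> 's::semiring per \<Rightarrow> 's per"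
  assumes "\<And>A C. cand C \<Longrightarrow> cand (EB A C)"
  shows "cand (all_per EB)"
  unfolding all_per_def
proof (rule cand_pull)
  show "\<exists>p. s \<simeq> TLam p" if "s \<simeq> t" "\<exists>p. t \<simeq> TLam p" for s t :: "'s trm"
    using that by (meson equivclp_trans)
  show "\<exists>p. s \<boxplus> t \<simeq> TLam p" if "\<exists>p. s \<simeq> TLam p" "\<exists>p. t \<simeq> TLam p" for s t :: "'s trm"
    using that by (meson conv_TLam_sum)
  show "\<exists>p. a \<bullet>\<^sub>s s \<simeq> TLam p" if "\<exists>p. s \<simeq> TLam p" for a and s :: "'s trm"
    using that by (meson conv_TLam_scal)
qed (auto simp: assms conv_TApp simp del: split_paired_Ex intro: TApp_sum TApp_scal)

section \<open>Semantic validity\<close>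

type_synonym 's sctx = "nat \<Rightarrow> 's per option"

definition env_eq :: "'s::semiring sctx \<Rightarrow> (nat \<Rightarrow> 's trm) \<Rightarrow> (nat \<Rightarrow> 's trm) \<Rightarrow> bool" where
  "env_eq G \<sigma> \<sigma>' \<longleftrightarrow> (\<forall>x. case G x of None \<Rightarrow> True | Some E \<Rightarrow> E (\<sigma> x) (\<sigma>' x))"

text \<open>The variable \<open>x\<close> carries the combination while all others are held fixed,
  up to their candidates. Using three environments instead of updates of one keeps the notion stable
  under binders and splitting. Reflexivity at \<open>x\<close> is demanded because candidates are
  partial. For scalars, \<sigma>2 is only a placeholder.\<close>

definition env_lin ::
  "('s trm \<Rightarrow> 's trm \<Rightarrow> 's trm) \<Rightarrow> nat \<Rightarrow> 's::semiring sctx \<Rightarrow>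
    (nat \<Rightarrow> 's trm) \<Rightarrow> (nat \<Rightarrow> 's trm) \<Rightarrow> (nat \<Rightarrow> 's trm) \<Rightarrow> bool" where
  "env_lin \<omega> x G \<sigma> \<sigma>1 \<sigma>2 \<longleftrightarrow>
    (\<exists>E. G x = Some E \<and> E (\<sigma> x) (\<omega> (\<sigma>1 x) (\<sigma>2 x)) \<and> E (\<sigma>1 x) (\<sigma>1 x) \<and> E (\<sigma>2 x) (\<sigma>2 x)) \<and>
    env_eq (G(x := None)) \<sigma> \<sigma>1 \<and> env_eq (G(x := None)) \<sigma> \<sigma>2"

definition valid :: "'s::semiring sctx \<Rightarrow> ((nat \<Rightarrow> 's trm) \<Rightarrow> 's trm) \<Rightarrow> 's per \<Rightarrow> bool" where
  "valid G F E \<longleftrightarrow> (\<forall>\<sigma> \<sigma>'. env_eq G \<sigma> \<sigma>' \<longrightarrow> E (F \<sigma>) (F \<sigma>')) \<and>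
    (\<forall>\<omega> x \<sigma> \<sigma>1 \<sigma>2. lin_op \<omega> \<longrightarrow> env_lin \<omega> x G \<sigma> \<sigma>1 \<sigma>2 \<longrightarrow> E (F \<sigma>) (\<omega> (F \<sigma>1) (F \<sigma>2)))"

definition cands :: "'s::semiring sctx \<Rightarrow> bool" where
  "cands G \<longleftrightarrow> (\<forall>x E. G x = Some E \<longrightarrow> cand E)"

lemma valid_cong: "valid G F E \<Longrightarrow> env_eq G \<sigma> \<sigma>' \<Longrightarrow> E (F \<sigma>) (F \<sigma>')"
  by (simp add: valid_def)

lemma valid_lin:
  "valid G F E \<Longrightarrow> lin_op \<omega> \<Longrightarrow> env_lin \<omega> x G \<sigma> \<sigma>1 \<sigma>2 \<Longrightarrow> E (F \<sigma>) (\<omega> (F \<sigma>1) (F \<sigma>2))"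
  by (simp add: valid_def)

lemma validI:
  assumes "\<And>\<sigma> \<sigma>'. env_eq G \<sigma> \<sigma>' \<Longrightarrow> E (F \<sigma>) (F \<sigma>')"
    and "\<And>\<omega> x \<sigma> \<sigma>1 \<sigma>2. lin_op \<omega> \<Longrightarrow> env_lin \<omega> x G \<sigma> \<sigma>1 \<sigma>2 \<Longrightarrow> E (F \<sigma>) (\<omega> (F \<sigma>1) (F \<sigma>2))"
  shows "valid G F E"
  using assms by (simp add: valid_def)

lemma env_eqI:
  assumes "\<And>x E. G x = Some E \<Longrightarrow> E (\<sigma> x) (\<sigma>' x)"
  shows "env_eq G \<sigma> \<sigma>'"
  unfolding env_eq_def
proof
  fix x
  show "case G x of None \<Rightarrow> True | Some E \<Rightarrow> E (\<sigma> x) (\<sigma>' x)"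
    using assms[of x "the (G x)"] by (cases "G x") simp_all
qed

lemma env_eqD: "env_eq G \<sigma> \<sigma>' \<Longrightarrow> G x = Some E \<Longrightarrow> E (\<sigma> x) (\<sigma>' x)"
  unfolding env_eq_def by (drule spec[of _ x]) simp

lemma candsD: "cands G \<Longrightarrow> G x = Some E \<Longrightarrow> cand E"
  by (simp add: cands_def)

lemma cands_upd_None: "cands G \<Longrightarrow> cands (G(x := None))"
  by (simp add: cands_def)

lemma all_nat_case: "(\<forall>x::nat. P x) \<longleftrightarrow> P 0 \<and> (\<forall>x. P (Suc x))"
  by (rule iffI, simp, rule allI, induct_tac x) simp_all

lemma env_eq_sym: "cands G \<Longrightarrow> env_eq G \<sigma> \<sigma>' \<Longrightarrow> env_eq G \<sigma>' \<sigma>"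
  by (rule env_eqI, rule cand.sym[OF candsD env_eqD])

lemma env_eq_trans: "cands G \<Longrightarrow> env_eq G \<sigma> \<sigma>' \<Longrightarrow> env_eq G \<sigma>' \<sigma>'' \<Longrightarrow> env_eq G \<sigma> \<sigma>''"
  by (rule env_eqI, rule cand.trans[OF candsD env_eqD env_eqD])

lemma env_eq_refl:
  assumes "cands G" "env_eq G \<sigma> \<sigma>'"
  shows "env_eq G \<sigma> \<sigma>" "env_eq G \<sigma>' \<sigma>'"
  by (rule env_eq_trans[OF assms(1) assms(2) env_eq_sym[OF assms]])
    (rule env_eq_trans[OF assms(1) env_eq_sym[OF assms] assms(2)])

lemma env_linE:
  assumes "env_lin \<omega> x G \<sigma> \<sigma>1 \<sigma>2"
  obtains E where "G x = Some E" "E (\<sigma> x) (\<omega> (\<sigma>1 x) (\<sigma>2 x))" "E (\<sigma>1 x) (\<sigma>1 x)" "E (\<sigma>2 x) (\<sigma>2 x)"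
    and "env_eq (G(x := None)) \<sigma> \<sigma>1" "env_eq (G(x := None)) \<sigma> \<sigma>2"
  using assms unfolding env_lin_def by (elim conjE exE) (rule that)

lemma env_lin_refl:
  assumes "cands G" "env_lin \<omega> x G \<sigma> \<sigma>1 \<sigma>2"
  shows "env_eq G \<sigma> \<sigma>" "env_eq G \<sigma>1 \<sigma>1" "env_eq G \<sigma>2 \<sigma>2"
proof -
  from assms(2) obtain E where E: "G x = Some E" "E (\<sigma> x) (\<omega> (\<sigma>1 x) (\<sigma>2 x))"
      "E (\<sigma>1 x) (\<sigma>1 x)" "E (\<sigma>2 x) (\<sigma>2 x)"
    and eq: "env_eq (G(x := None)) \<sigma> \<sigma>1" "env_eq (G(x := None)) \<sigma> \<sigma>2"
    by (rule env_linE)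
  have *: "env_eq G \<tau> \<tau>" if "env_eq (G(x := None)) \<tau> \<tau>" "E (\<tau> x) (\<tau> x)" for \<tau>
  proof (rule env_eqI)
    show "E' (\<tau> y) (\<tau> y)" if "G y = Some E'" for y E'
      using that E(1) \<open>E (\<tau> x) (\<tau> x)\<close> env_eqD[OF \<open>env_eq _ \<tau> \<tau>\<close>, of y E']
      by (cases "y = x") simp_all
  qed
  note c = cands_upd_None[OF assms(1), of x]
  show "env_eq G \<sigma> \<sigma>"
    by (rule *[OF env_eq_refl(1)[OF c eq(1)] cand.refl_left[OF candsD[OF assms(1) E(1)] E(2)]])
  show "env_eq G \<sigma>1 \<sigma>1" "env_eq G \<sigma>2 \<sigma>2"
    by (rule *[OF env_eq_refl(2)[OF c eq(1)] E(3)]) (rule *[OF env_eq_refl(2)[OF c eq(2)] E(4)])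
qed

lemma env_eq_case_nat:
  "env_eq (case_nat (Some E) G) (case_nat u \<sigma>) (case_nat v \<sigma>') \<longleftrightarrow> E u v \<and> env_eq G \<sigma> \<sigma>'"
  unfolding env_eq_def by (subst all_nat_case) (simp cong: option.case_cong)

lemma env_lin_case_nat_Suc:
  assumes "env_lin \<omega> x G \<sigma> \<sigma>1 \<sigma>2" "E u u1" "E u u2"
  shows "env_lin \<omega> (Suc x) (case_nat (Some E) G) (case_nat u \<sigma>) (case_nat u1 \<sigma>1) (case_nat u2 \<sigma>2)"
proof -
  have "(case_nat (Some E) G)(Suc x := None) = case_nat (Some E) (G(x := None))"
    by (rule ext) (simp split: nat.split)
  with assms show ?thesis unfolding env_lin_def by (simp add: env_eq_case_nat)
qed

lemma env_lin_case_nat_0: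
  assumes "env_eq G \<sigma> \<sigma>" "E (\<omega> u v) (\<omega> u v)" "E u u" "E v v"
  shows "env_lin \<omega> 0 (case_nat (Some E) G) (case_nat (\<omega> u v) \<sigma>) (case_nat u \<sigma>) (case_nat v \<sigma>)"
proof -
  have "env_eq ((case_nat (Some E) G)(0 := None)) (case_nat (\<omega> u v) \<sigma>) (case_nat w \<sigma>)" for w
    using assms(1) unfolding env_eq_def
    by (subst all_nat_case) (simp cong: option.case_cong)
  with assms(2-4) show ?thesis by (simp add: env_lin_def)
qed

lemma env_eq_map_add:
  assumes "dom G \<inter> dom D = {}" "env_eq (G ++ D) \<sigma> \<sigma>'"
  shows "env_eq G \<sigma> \<sigma>'" "env_eq D \<sigma> \<sigma>'"
proof -
  show "env_eq D \<sigma> \<sigma>'"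
    by (rule env_eqI, rule env_eqD[OF assms(2)]) simp
  show "env_eq G \<sigma> \<sigma>'"
  proof (rule env_eqI, rule env_eqD[OF assms(2)])
    show "(G ++ D) x = Some E" if "G x = Some E" for x E
      using assms(1) that by (auto simp: map_add_Some_iff)
  qed
qed

text \<open>Linearity of contexts enters here: \<open>x\<close> belongs to exactly one of the two
  parts, and on the other part all three environments agree.\<close>

lemma env_lin_map_add:
  assumes "dom G \<inter> dom D = {}" "env_lin \<omega> x (G ++ D) \<sigma> \<sigma>1 \<sigma>2"
  obtains "env_lin \<omega> x G \<sigma> \<sigma>1 \<sigma>2" "env_eq D \<sigma> \<sigma>1" "env_eq D \<sigma> \<sigma>2"
  | "env_lin \<omega> x D \<sigma> \<sigma>1 \<sigma>2" "env_eq G \<sigma> \<sigma>1" "env_eq G \<sigma> \<sigma>2"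
proof -
  let ?G = "G(x := None)" and ?D = "D(x := None)"
  have upd: "(G ++ D)(x := None) = ?G ++ ?D"
    by (rule ext) (simp add: map_add_def split: option.split)
  have "dom ?G \<inter> dom ?D = {}" using assms(1) by auto
  note eq = env_eq_map_add[OF this]
  from assms(2) obtain E where E: "(G ++ D) x = Some E" "E (\<sigma> x) (\<omega> (\<sigma>1 x) (\<sigma>2 x))"
      "E (\<sigma>1 x) (\<sigma>1 x)" "E (\<sigma>2 x) (\<sigma>2 x)"
    and GD: "env_eq ((G ++ D)(x := None)) \<sigma> \<sigma>1" "env_eq ((G ++ D)(x := None)) \<sigma> \<sigma>2"
    by (rule env_linE)
  note eqs = eq[OF GD(1)[unfolded upd]] eq[OF GD(2)[unfolded upd]]
  show thesis
  \<comment> \<open>The union is biased to the right, so membership in \<open>D\<close> decides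
    which part owns \<open>x\<close>.\<close>
  proof (cases "D x")
    case None
    then have D: "?D = D" and G: "G x = Some E"
      using E(1) by (simp_all add: fun_upd_idem map_add_def)
    have lin: "env_lin \<omega> x G \<sigma> \<sigma>1 \<sigma>2"
      unfolding env_lin_def using E(2-4) eqs(1,3) by (simp add: G)
    show thesis by (rule that(1)[OF lin eqs(2,4)[unfolded D]])
  next
    case (Some E')
    then have "G x = None" using assms(1) by auto
    then have G: "?G = G" and D: "D x = Some E"
      using E(1) Some by (simp_all add: fun_upd_idem map_add_def)
    have lin: "env_lin \<omega> x D \<sigma> \<sigma>1 \<sigma>2"
      unfolding env_lin_def using E(2-4) eqs(2,4) by (simp add: D)
    show thesis by (rule that(2)[OF lin eqs(1,3)[unfolded G]])
  qed
qed

section \<open>Closure properties of validity\<close>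

lemma valid_conv:
  assumes "cand E" "valid G F E" "\<And>\<sigma>. F' \<sigma> \<simeq> F \<sigma>"
  shows "valid G F' E"
proof (rule validI)
  interpret cand E by fact
  show "E (F' \<sigma>) (F' \<sigma>')" if "env_eq G \<sigma> \<sigma>'" for \<sigma> \<sigma>'
    by (rule conv[OF assms(3) assms(3) valid_cong[OF assms(2) that]])
  show "E (F' \<sigma>) (\<omega> (F' \<sigma>1) (F' \<sigma>2))" if "lin_op \<omega>" "env_lin \<omega> x G \<sigma> \<sigma>1 \<sigma>2" for \<omega> x \<sigma> \<sigma>1 \<sigma>2
    by (rule conv[OF assms(3) conv_op[OF that(1) assms(3) assms(3)] valid_lin[OF assms(2) that]])
qed

lemma valid_op:
  assumes "cand E" "cands G" "lin_op \<omega>'" "valid G F E" "valid G F' E"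
  shows "valid G (\<lambda>\<sigma>. \<omega>' (F \<sigma>) (F' \<sigma>)) E"
proof (rule validI)
  interpret cand E by fact
  show "E (\<omega>' (F \<sigma>) (F' \<sigma>)) (\<omega>' (F \<sigma>') (F' \<sigma>'))" if "env_eq G \<sigma> \<sigma>'" for \<sigma> \<sigma>'
    by (rule op_closed[OF assms(3) valid_cong[OF assms(4) that] valid_cong[OF assms(5) that]])
  show "E (\<omega>' (F \<sigma>) (F' \<sigma>)) (\<omega> (\<omega>' (F \<sigma>1) (F' \<sigma>1)) (\<omega>' (F \<sigma>2) (F' \<sigma>2)))"
    if "lin_op \<omega>" "env_lin \<omega> x G \<sigma> \<sigma>1 \<sigma>2" for \<omega> x \<sigma> \<sigma>1 \<sigma>2
  proof -
    note r = env_lin_refl[OF assms(2) that(2)]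
    show ?thesis
      by (rule trans[OF op_closed[OF assms(3) valid_lin[OF assms(4) that] valid_lin[OF assms(5) that]]
            op_interchange[OF that(1) assms(3) valid_cong[OF assms(4) r(2)] valid_cong[OF assms(4) r(3)]
              valid_cong[OF assms(5) r(2)] valid_cong[OF assms(5) r(3)]]])
  qed
qed

lemma valid_Sum:
  "cand E \<Longrightarrow> cands G \<Longrightarrow> valid G F E \<Longrightarrow> valid G F' E \<Longrightarrow> valid G (\<lambda>\<sigma>. F \<sigma> \<boxplus> F' \<sigma>) E"
  by (rule valid_op[OF _ _ lin_op_Sum])

text \<open>Not an instance of \<open>valid_op\<close>: a term may contain arbitrary scalars,
  whereas \<open>lin_op\<close> provides central ones. Only the operation tested for linearity has
  to be central.\<close>

lemma valid_Scal:
  assumes "cand E" "cands G" "valid G F E"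
  shows "valid G (\<lambda>\<sigma>. a \<bullet>\<^sub>s F \<sigma>) E"
proof (rule validI)
  interpret cand E by fact
  show "E (a \<bullet>\<^sub>s F \<sigma>) (a \<bullet>\<^sub>s F \<sigma>')" if "env_eq G \<sigma> \<sigma>'" for \<sigma> \<sigma>'
    by (rule scal[OF valid_cong[OF assms(3) that]])
  show "E (a \<bullet>\<^sub>s F \<sigma>) (\<omega> (a \<bullet>\<^sub>s F \<sigma>1) (a \<bullet>\<^sub>s F \<sigma>2))"
    if "lin_op \<omega>" "env_lin \<omega> x G \<sigma> \<sigma>1 \<sigma>2" for \<omega> x \<sigma> \<sigma>1 \<sigma>2
  proof -
    note r = env_lin_refl[OF assms(2) that(2)]
    show ?thesis
      by (rule trans[OF scal[OF valid_lin[OF assms(3) that]]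
            op_scal[OF that(1) valid_cong[OF assms(3) r(2)] valid_cong[OF assms(3) r(3)]]])
  qed
qed

lemma valid_inst:
  assumes "valid (case_nat (Some E) G) F C" "E u u"
  shows "valid G (\<lambda>\<sigma>. F (case_nat u \<sigma>)) C"
proof (rule validI)
  show "C (F (case_nat u \<sigma>)) (F (case_nat u \<sigma>'))" if "env_eq G \<sigma> \<sigma>'" for \<sigma> \<sigma>'
    by (rule valid_cong[OF assms(1)]) (simp add: env_eq_case_nat assms(2) that)
  show "C (F (case_nat u \<sigma>)) (\<omega> (F (case_nat u \<sigma>1)) (F (case_nat u \<sigma>2)))"
    if "lin_op \<omega>" "env_lin \<omega> x G \<sigma> \<sigma>1 \<sigma>2" for \<omega> x \<sigma> \<sigma>1 \<sigma>2
    by (rule valid_lin[OF assms(1) that(1) env_lin_case_nat_Suc[of \<omega> x G _ _ _ E, OF that(2) assms(2) assms(2)]])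
qed

text \<open>Linearity in the variable just bound, at index 0. It makes abstractions linear maps and
  makes bodies of eliminations respect the equations imposed in the free modules.\<close>

lemma valid_bind_lin:
  assumes "cand E" "valid (case_nat (Some E) G) F C" "env_eq G \<sigma> \<sigma>" "lin_op \<omega>" "E u u" "E v v"
  shows "C (F (case_nat (\<omega> u v) \<sigma>)) (\<omega> (F (case_nat u \<sigma>)) (F (case_nat v \<sigma>)))"
  by (rule valid_lin[OF assms(2,4) env_lin_case_nat_0[of G \<sigma> E \<omega> u v,
        OF assms(3) cand.op_closed[OF assms(1,4,5,6)] assms(5,6)]])

text \<open>The common shape of all rules that split the context: \<open>K\<close> is a bilinear operation of which
  the second argument has already been composed with the environment.\<close>

lemma valid_bilinear:
  assumes C: "cand C" and G: "cands G" and D: "cands D" and disj: "dom G \<inter> dom D = {}"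
    and F: "valid G F E"
    and K1: "\<And>\<sigma> s t. env_eq D \<sigma> \<sigma> \<Longrightarrow> E s t \<Longrightarrow> C (K \<sigma> s) (K \<sigma> t)"
    and K2: "\<And>s. E s s \<Longrightarrow> valid D (\<lambda>\<sigma>. K \<sigma> s) C"
    and K3: "\<And>\<sigma> \<omega> s t. env_eq D \<sigma> \<sigma> \<Longrightarrow> lin_op \<omega> \<Longrightarrow> E s s \<Longrightarrow> E t t \<Longrightarrow>
      C (K \<sigma> (\<omega> s t)) (\<omega> (K \<sigma> s) (K \<sigma> t))"
  shows "valid (G ++ D) (\<lambda>\<sigma>. K \<sigma> (F \<sigma>)) C"
proof (rule validI)
  interpret cand C by (rule C)
  fix \<sigma> \<sigma>' assume "env_eq (G ++ D) \<sigma> \<sigma>'"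
  note eq = env_eq_map_add[OF disj this]
  have "C (K \<sigma> (F \<sigma>)) (K \<sigma> (F \<sigma>'))"
    by (rule K1[OF env_eq_refl(1)[OF D eq(2)] valid_cong[OF F eq(1)]])
  moreover have "C (K \<sigma> (F \<sigma>')) (K \<sigma>' (F \<sigma>'))"
    by (rule valid_cong[OF K2 eq(2)]) (rule valid_cong[OF F env_eq_refl(2)[OF G eq(1)]])
  ultimately show "C (K \<sigma> (F \<sigma>)) (K \<sigma>' (F \<sigma>'))" by (rule trans)
next
  interpret cand C by (rule C)
  fix \<omega> x \<sigma> \<sigma>1 \<sigma>2 assume \<omega>: "lin_op \<omega>" and "env_lin \<omega> x (G ++ D) \<sigma> \<sigma>1 \<sigma>2"
  from disj this(2) show "C (K \<sigma> (F \<sigma>)) (\<omega> (K \<sigma>1 (F \<sigma>1)) (K \<sigma>2 (F \<sigma>2)))"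
  proof (cases rule: env_lin_map_add)
    \<comment> \<open>The variable lies in the context of the principal argument: \<open>K3\<close>
      splits the combination, then \<open>K2\<close> moves each half from \<sigma> to its own
      environment.\<close>
    case 1
    note r = env_lin_refl[OF G 1(1)] and d = env_eq_refl(1)[OF D 1(2)]
    note Fr = valid_cong[OF F r(2)] valid_cong[OF F r(3)]
    have "C (K \<sigma> (F \<sigma>)) (K \<sigma> (\<omega> (F \<sigma>1) (F \<sigma>2)))"
      by (rule K1[OF d valid_lin[OF F \<omega> 1(1)]])
    moreover have "C (K \<sigma> (\<omega> (F \<sigma>1) (F \<sigma>2))) (\<omega> (K \<sigma> (F \<sigma>1)) (K \<sigma> (F \<sigma>2)))"
      by (rule K3[OF d \<omega> Fr])
    moreover have "C (\<omega> (K \<sigma> (F \<sigma>1)) (K \<sigma> (F \<sigma>2))) (\<omega> (K \<sigma>1 (F \<sigma>1)) (K \<sigma>2 (F \<sigma>2)))"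
      by (rule op_closed[OF \<omega> valid_cong[OF K2[OF Fr(1)] 1(2)] valid_cong[OF K2[OF Fr(2)] 1(3)]])
    ultimately show ?thesis by (rule trans[OF _ trans])
  next
    case 2
    note r = env_lin_refl[OF D 2(1)]
    have "C (K \<sigma> (F \<sigma>)) (\<omega> (K \<sigma>1 (F \<sigma>)) (K \<sigma>2 (F \<sigma>)))"
      by (rule valid_lin[OF K2 \<omega> 2(1)]) (rule valid_cong[OF F env_eq_refl(1)[OF G 2(2)]])
    moreover have "C (\<omega> (K \<sigma>1 (F \<sigma>)) (K \<sigma>2 (F \<sigma>))) (\<omega> (K \<sigma>1 (F \<sigma>1)) (K \<sigma>2 (F \<sigma>2)))"
      by (rule op_closed[OF \<omega> K1[OF r(2) valid_cong[OF F 2(2)]] K1[OF r(3) valid_cong[OF F 2(3)]]])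
    ultimately show ?thesis by (rule trans)
  qed
qed

lemma valid_linear:
  assumes C: "cand C" and G: "cands G" and F: "valid G F E"
    and K1: "\<And>s t. E s t \<Longrightarrow> C (K s) (K t)"
    and K2: "\<And>\<omega> s t. lin_op \<omega> \<Longrightarrow> E s s \<Longrightarrow> E t t \<Longrightarrow> C (K (\<omega> s t)) (\<omega> (K s) (K t))"
  shows "valid G (\<lambda>\<sigma>. K (F \<sigma>)) C"
proof (rule validI)
  show "C (K (F \<sigma>)) (K (F \<sigma>'))" if "env_eq G \<sigma> \<sigma>'" for \<sigma> \<sigma>'
    by (rule K1[OF valid_cong[OF F that]])
  show "C (K (F \<sigma>)) (\<omega> (K (F \<sigma>1)) (K (F \<sigma>2)))"
    if "lin_op \<omega>" "env_lin \<omega> x G \<sigma> \<sigma>1 \<sigma>2" for \<omega> x \<sigma> \<sigma>1 \<sigma>2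
  proof -
    note r = env_lin_refl[OF G that(2)]
    show ?thesis
      by (rule cand.trans[OF C K1[OF valid_lin[OF F that]]
            K2[OF that(1) valid_cong[OF F r(2)] valid_cong[OF F r(3)]]])
  qed
qed

section \<open>Validity of the typing rules\<close>

lemma valid_Var: "valid [x \<mapsto> E] (\<lambda>\<sigma>. \<sigma> x) E"
proof (rule validI)
  show "E (\<sigma> x) (\<sigma>' x)" if "env_eq [x \<mapsto> E] \<sigma> \<sigma>'" for \<sigma> \<sigma>'
    by (rule env_eqD[OF that]) simp
  show "E (\<sigma> x) (\<omega> (\<sigma>1 x) (\<sigma>2 x))" if "env_lin \<omega> y [x \<mapsto> E] \<sigma> \<sigma>1 \<sigma>2" for \<omega> y \<sigma> \<sigma>1 \<sigma>2
    using that by (auto simp: env_lin_def split: if_splits)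
qed

lemma valid_Star: "valid Map.empty (\<lambda>_. Star a) one_per"
proof (rule validI)
  show "one_per (Star a) (Star a)" unfolding one_per_def by (rule exI[of _ a]) simp
qed (simp add: env_lin_def)

text \<open>A constant is linear in a variable it ignores only if it absorbs the operations.
  \<open>Unit\<close> does so by reduction, which justifies the arbitrary context in its typing
  rule.\<close>

lemma valid_Unit: "valid G (\<lambda>_. Unit) top_per"
proof (rule validI)
  have "\<omega> Unit Unit \<simeq> (Unit :: 's trm)" if "lin_op \<omega>" for \<omega> :: "'s::semiring trm \<Rightarrow> 's trm \<Rightarrow> 's trm"
    using that by cases (simp_all add: conv_red R_Sum_Unit R_Scal_Unit)
  then show "top_per Unit (\<omega> Unit Unit)"
    if "lin_op \<omega>" for \<omega> :: "'s::semiring trm \<Rightarrow> 's trm \<Rightarrow> 's trm"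
    using that by (simp add: top_per_def pull_def)
qed (simp add: top_per_def pull_def)

text \<open>Any \<open>H\<close> is valid vacuously: a valid \<open>F\<close> into the empty
  relation means that no environment satisfies \<open>G\<close>, and both conditions on
  \<open>G ++ D\<close> would provide one.\<close>

lemma valid_ZeroE:
  assumes "dom G \<inter> dom D = {}" "valid G F (\<lambda>_ _. False)"
  shows "valid (G ++ D) H C"
proof (rule validI)
  have no: "\<not> env_eq G \<sigma> \<sigma>'" for \<sigma> \<sigma>' using valid_cong[OF assms(2), of \<sigma> \<sigma>'] by metis
  show "C (H \<sigma>) (H \<sigma>')" if "env_eq (G ++ D) \<sigma> \<sigma>'" for \<sigma> \<sigma>'
    using no env_eq_map_add(1)[OF assms(1) that] by (rule notE)
  show "C (H \<sigma>) (\<omega> (H \<sigma>1) (H \<sigma>2))"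
    if "lin_op \<omega>" "env_lin \<omega> x (G ++ D) \<sigma> \<sigma>1 \<sigma>2" for \<omega> x \<sigma> \<sigma>1 \<sigma>2
    using assms(1) that(2)
  proof (cases rule: env_lin_map_add)
    case 1
    from valid_lin[OF assms(2) that(1) 1(1)] show ?thesis ..
  next
    case 2
    from no 2(2) show ?thesis by (rule notE)
  qed
qed

lemma with_per_Pair:
  assumes "cand EA" "cand EB" "EA p p'" "EB q q'"
  shows "with_per EA EB (Pair p q) (Pair p' q')"
  unfolding with_per_iff[OF assms(1,2)] using assms(3,4) by (metis equivclp_refl)

lemma valid_Pair:
  assumes EA: "cand EA" and EB: "cand EB" and F: "valid G F EA" "valid G F' EB"
  shows "valid G (\<lambda>\<sigma>. Pair (F \<sigma>) (F' \<sigma>)) (with_per EA EB)"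
proof (rule validI)
  show "with_per EA EB (Pair (F \<sigma>) (F' \<sigma>)) (Pair (F \<sigma>') (F' \<sigma>'))" if "env_eq G \<sigma> \<sigma>'" for \<sigma> \<sigma>'
    by (rule with_per_Pair[OF EA EB valid_cong[OF F(1) that] valid_cong[OF F(2) that]])
  show "with_per EA EB (Pair (F \<sigma>) (F' \<sigma>)) (\<omega> (Pair (F \<sigma>1) (F' \<sigma>1)) (Pair (F \<sigma>2) (F' \<sigma>2)))"
    if "lin_op \<omega>" "env_lin \<omega> x G \<sigma> \<sigma>1 \<sigma>2" for \<omega> x \<sigma> \<sigma>1 \<sigma>2
    by (rule cand.conv_right[OF cand_with[OF EA EB] _ op_Pair[OF that(1)]])
      (rule with_per_Pair[OF EA EB valid_lin[OF F(1) that] valid_lin[OF F(2) that]])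
qed

text \<open>The hypothesis on \<open>F\<close> is used twice: linearity at index 0 puts the
  abstraction into \<open>lin_fun\<close>, and linearity at the shifted indices makes the
  abstraction depend linearly on the environment.\<close>

lemma valid_Lam:
  assumes EA: "cand EA" and EB: "cand EB" and G: "cands G"
    and F: "valid (case_nat (Some EA) G) F EB"
    and b: "\<And>\<sigma> u. subst1 u (b \<sigma>) = F (case_nat u \<sigma>)"
  shows "valid G (\<lambda>\<sigma>. Lam A (b \<sigma>)) (lolli_per A EA EB)"
proof (rule validI)
  interpret cand EB by (rule EB)
  have \<beta>: "App (Lam A (b \<sigma>)) u \<simeq> F (case_nat u \<sigma>)" for \<sigma> u
    using conv_beta[OF equivclp_refl, of A "b \<sigma>" u] by (simp add: b)
  have lin: "lin_fun A EA EB (Lam A (b \<sigma>))" if \<sigma>: "env_eq G \<sigma> \<sigma>" for \<sigma>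
    unfolding lin_fun_def
  proof (intro conjI allI impI)
    show "\<exists>t. Lam A (b \<sigma>) \<simeq> Lam A t" by (rule exI) (rule equivclp_refl)
    show "EB (App (Lam A (b \<sigma>)) u) (App (Lam A (b \<sigma>)) v)" if "EA u v" for u v
      by (rule conv[OF \<beta> \<beta> valid_cong[OF F]]) (simp add: env_eq_case_nat that \<sigma>)
    show "EB (App (Lam A (b \<sigma>)) (\<omega> u v)) (\<omega> (App (Lam A (b \<sigma>)) u) (App (Lam A (b \<sigma>)) v))"
      if "lin_op \<omega>" "EA u u" "EA v v" for \<omega> u v
      by (rule conv[OF \<beta> conv_op[OF that(1) \<beta> \<beta>] valid_bind_lin[OF EA F \<sigma> that]])
  qed
  show "lolli_per A EA EB (Lam A (b \<sigma>)) (Lam A (b \<sigma>'))" if "env_eq G \<sigma> \<sigma>'" for \<sigma> \<sigma>'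
  proof -
    have "EB (App (Lam A (b \<sigma>)) u) (App (Lam A (b \<sigma>')) u)" if "EA u u" for u
      by (rule conv[OF \<beta> \<beta> valid_cong[OF F]]) (simp add: env_eq_case_nat that \<open>env_eq G \<sigma> \<sigma>'\<close>)
    then show ?thesis
      using lin env_eq_refl[OF G that] by (simp add: lolli_per_def pull_def)
  qed
  note cong = this
  show "lolli_per A EA EB (Lam A (b \<sigma>)) (\<omega> (Lam A (b \<sigma>1)) (Lam A (b \<sigma>2)))"
    if "lin_op \<omega>" "env_lin \<omega> x G \<sigma> \<sigma>1 \<sigma>2" for \<omega> x \<sigma> \<sigma>1 \<sigma>2
  proof -
    note r = env_lin_refl[OF G that(2)]
    have "EB (App (Lam A (b \<sigma>)) u) (App (\<omega> (Lam A (b \<sigma>1)) (Lam A (b \<sigma>2))) u)" if "EA u u" for u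
    proof (rule conv[OF \<beta> equivclp_trans[OF App_op[OF \<open>lin_op \<omega>\<close> lin[OF r(2)] lin[OF r(3)]]
            conv_op[OF \<open>lin_op \<omega>\<close> \<beta> \<beta>]]])
      show "EB (F (case_nat u \<sigma>)) (\<omega> (F (case_nat u \<sigma>1)) (F (case_nat u \<sigma>2)))"
        by (rule valid_lin[OF F \<open>lin_op \<omega>\<close> env_lin_case_nat_Suc[of _ x]]; fact)
    qed
    \<comment> \<open>That the combination is again a linear abstraction is read off from closure of
      the candidate under \<omega>.\<close>
    moreover have "lin_fun A EA EB (\<omega> (Lam A (b \<sigma>1)) (Lam A (b \<sigma>2)))"
      using cand.op_closed[OF cand_lolli[OF EB] that(1) cong[OF r(2)] cong[OF r(3)]]
      by (simp add: lolli_per_def pull_def)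
    ultimately show ?thesis using lin[OF r(1)] by (simp add: lolli_per_def pull_def)
  qed
qed

text \<open>\<open>G\<close> does not depend on \<open>A\<close> or \<open>C\<close>: this is the
  semantic content of the bound type variable not occurring in the context.\<close>

lemma valid_TLam:
  assumes EB: "\<And>A C. cand C \<Longrightarrow> cand (EB A C)" and G: "cands G"
    and F: "\<And>A C. cand C \<Longrightarrow> valid G (F A) (EB A C)"
    and b: "\<And>\<sigma> A. tpsubst1 A (b \<sigma>) = F A \<sigma>"
  shows "valid G (\<lambda>\<sigma>. TLam (b \<sigma>)) (all_per EB)"
proof (rule validI)
  have D: "\<exists>t. TLam (b \<sigma>) \<simeq> TLam t" for \<sigma>
    by (rule exI) (rule equivclp_refl)
  have \<beta>: "TApp (TLam (b \<sigma>)) A \<simeq> F A \<sigma>" for \<sigma> A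
    using conv_TLam_beta[OF equivclp_refl, of "b \<sigma>" A] by (simp add: b)
  show cong: "all_per EB (TLam (b \<sigma>)) (TLam (b \<sigma>'))" if "env_eq G \<sigma> \<sigma>'" for \<sigma> \<sigma>'
  proof -
    have "EB A C (TApp (TLam (b \<sigma>)) A) (TApp (TLam (b \<sigma>')) A)" if "cand C" for A C
      by (rule cand.conv[OF EB[OF that] \<beta> \<beta> valid_cong[OF F[OF that] \<open>env_eq G \<sigma> \<sigma>'\<close>]])
    with D show ?thesis by (auto simp: all_per_def pull_def)
  qed
  show "all_per EB (TLam (b \<sigma>)) (\<omega> (TLam (b \<sigma>1)) (TLam (b \<sigma>2)))"
    if "lin_op \<omega>" "env_lin \<omega> x G \<sigma> \<sigma>1 \<sigma>2" for \<omega> x \<sigma> \<sigma>1 \<sigma>2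
  proof -
    note r = env_lin_refl[OF G that(2)]
    have "EB A C (TApp (TLam (b \<sigma>)) A) (TApp (\<omega> (TLam (b \<sigma>1)) (TLam (b \<sigma>2))) A)"
      if "cand C" for A C
      by (rule cand.conv[OF EB[OF that] \<beta> equivclp_trans[OF TApp_op[OF \<open>lin_op \<omega>\<close> D D]
            conv_op[OF \<open>lin_op \<omega>\<close> \<beta> \<beta>]] valid_lin[OF F[OF that] \<open>lin_op \<omega>\<close> \<open>env_lin _ _ _ _ _ _\<close>]])
    moreover have "\<exists>t. \<omega> (TLam (b \<sigma>1)) (TLam (b \<sigma>2)) \<simeq> TLam t"
      using cand.op_closed[OF cand_all[of EB, OF EB] that(1) cong[OF r(2)] cong[OF r(3)]]
      by (simp add: all_per_def pull_def)
    ultimately show ?thesis using D by (auto simp: all_per_def pull_def)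
  qed
qed

lemma valid_TApp:
  assumes EB: "\<And>A C. cand C \<Longrightarrow> cand (EB A C)" and G: "cands G"
    and F: "valid G F (all_per EB)" and C: "cand C"
  shows "valid G (\<lambda>\<sigma>. TApp (F \<sigma>) A) (EB A C)"
proof (rule valid_linear[OF EB[OF C] G F])
  show K1: "EB A C (TApp s A) (TApp t A)" if "all_per EB s t" for s t
    using that C by (auto simp: all_per_def pull_def)
  show "EB A C (TApp (\<omega> s t) A) (\<omega> (TApp s A) (TApp t A))"
    if "lin_op \<omega>" "all_per EB s s" "all_per EB t t" for \<omega> s t
  proof (rule cand.conv_left[OF EB[OF C] TApp_op[OF that(1)]])
    show "EB A C (\<omega> (TApp s A) (TApp t A)) (\<omega> (TApp s A) (TApp t A))"
      by (rule cand.op_closed[OF EB[OF C] that(1) K1[OF that(2)] K1[OF that(3)]])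
  qed (use that in \<open>auto simp: all_per_def pull_def\<close>)
qed

lemma valid_InL:
  assumes "cands G" "valid G F EA"
  shows "valid G (\<lambda>\<sigma>. InL (F \<sigma>)) (free (plus_gen EA EB))"
  by (rule valid_linear[OF cand_free assms]) (simp_all add: gen plus_gen.intros)

lemma valid_InR:
  assumes "cands G" "valid G F EB"
  shows "valid G (\<lambda>\<sigma>. InR (F \<sigma>)) (free (plus_gen EA EB))"
  by (rule valid_linear[OF cand_free assms]) (simp_all add: gen plus_gen.intros)

lemma valid_App:
  assumes EB: "cand EB" and G: "cands G" and D: "cands D" and disj: "dom G \<inter> dom D = {}"
    and F: "valid G F (lolli_per A EA EB)" and F': "valid D F' EA"
  shows "valid (G ++ D) (\<lambda>\<sigma>. App (F \<sigma>) (F' \<sigma>)) EB"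
proof (rule valid_bilinear[OF EB G D disj F])
  interpret cand EB by (rule EB)
  show K1: "EB (App s (F' \<sigma>)) (App t (F' \<sigma>))"
    if "env_eq D \<sigma> \<sigma>" "lolli_per A EA EB s t" for \<sigma> s t
    using that valid_cong[OF F'] by (simp add: lolli_per_def pull_def)
  show "valid D (\<lambda>\<sigma>. App s (F' \<sigma>)) EB" if "lolli_per A EA EB s s" for s
    by (rule valid_linear[OF EB D F']) (use that in \<open>simp_all add: lolli_per_def pull_def lin_fun_def\<close>)
  show "EB (App (\<omega> s t) (F' \<sigma>)) (\<omega> (App s (F' \<sigma>)) (App t (F' \<sigma>)))"
    if "env_eq D \<sigma> \<sigma>" "lin_op \<omega>" "lolli_per A EA EB s s" "lolli_per A EA EB t t" for \<sigma> \<omega> s t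
  proof (rule conv_left[OF App_op[OF that(2)]])
    show "EB (\<omega> (App s (F' \<sigma>)) (App t (F' \<sigma>))) (\<omega> (App s (F' \<sigma>)) (App t (F' \<sigma>)))"
      by (rule op_closed[OF that(2) K1[OF that(1,3)] K1[OF that(1,4)]])
  qed (use that in \<open>auto simp: lolli_per_def pull_def\<close>)
qed

text \<open>The three clauses of \<open>tensor_gen\<close> are tailored to
  \<open>valid_bilinear\<close>: \<open>tensor_left\<close> gives linearity in the first factor,
  \<open>tensor_right\<close> in the second, \<open>tensor_base\<close> congruence.\<close>

lemma valid_Tens:
  assumes G: "cands G" and D: "cands D" and disj: "dom G \<inter> dom D = {}"
    and F: "valid G F EA" and F': "valid D F' EB"
  shows "valid (G ++ D) (\<lambda>\<sigma>. Tens (F \<sigma>) (F' \<sigma>)) (free (tensor_gen EA EB))"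
proof (rule valid_bilinear[OF cand_free G D disj F])
  show "valid D (\<lambda>\<sigma>. Tens s (F' \<sigma>)) (free (tensor_gen EA EB))" if "EA s s" for s
    by (rule valid_linear[OF cand_free D F'])
      (simp_all add: gen tensor_base tensor_right that)
qed (simp_all add: gen tensor_base tensor_left valid_cong[OF F'])

text \<open>Eliminating a term that converts to \<open>Star a\<close> amounts to multiplying by
  \<open>a\<close>. Linearity in the principal argument is therefore \<open>add_scal\<close> for
  sums and \<open>mult_scal\<close> for scalars.\<close>

lemma valid_OneE:
  assumes C: "cand C" and G: "cands G" and D: "cands D" and disj: "dom G \<inter> dom D = {}"
    and F: "valid G F one_per" and F': "valid D F' C"
  shows "valid (G ++ D) (\<lambda>\<sigma>. OneE (F \<sigma>) (F' \<sigma>)) C"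
proof (rule valid_bilinear[OF C G D disj F])
  interpret cand C by (rule C)
  have \<beta>: "OneE s u \<simeq> a \<bullet>\<^sub>s u" if "s \<simeq> Star a" for s u a
    by (rule equivclp_trans[OF conv_OneE[OF that] conv_red[OF R_One]])
  show "C (OneE s (F' \<sigma>)) (OneE t (F' \<sigma>))" if "env_eq D \<sigma> \<sigma>" "one_per s t" for \<sigma> s t
  proof -
    from that(2) obtain a where a: "s \<simeq> Star a" "t \<simeq> Star a" unfolding one_per_def by blast
    show ?thesis by (rule conv[OF \<beta>[OF a(1)] \<beta>[OF a(2)] scal[OF valid_cong[OF F' that(1)]]])
  qed
  show "valid D (\<lambda>\<sigma>. OneE s (F' \<sigma>)) C" if one: "one_per s s" for s
  proof -
    from one obtain a where a: "s \<simeq> Star a" unfolding one_per_def by blast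
    show ?thesis by (rule valid_conv[OF C valid_Scal[OF C D F'] \<beta>[OF a]])
  qed
  show "C (OneE (\<omega> s t) (F' \<sigma>)) (\<omega> (OneE s (F' \<sigma>)) (OneE t (F' \<sigma>)))"
    if "env_eq D \<sigma> \<sigma>" "lin_op \<omega>" "one_per s s" "one_per t t" for \<sigma> \<omega> s t
  proof -
    from that(3,4) obtain a b where ab: "s \<simeq> Star a" "t \<simeq> Star b" unfolding one_per_def by blast
    note u = valid_cong[OF F' that(1)]
    from that(2) show ?thesis
    proof cases
      case lin_op_Sum
      then show ?thesis
        by (simp add: conv[OF \<beta>[OF conv_Star_sum[OF ab]] conv_Sum[OF \<beta>[OF ab(1)] \<beta>[OF ab(2)]] add_scal[OF u]])
    next
      case (lin_op_Scal c)
      then show ?thesis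
        by (simp add: conv[OF \<beta>[OF conv_Star_scal[OF ab(1)]] conv_Scal[OF \<beta>[OF ab(1)]] mult_scal[OF u]])
    qed
  qed
qed

text \<open>The flag \<open>i\<close> selects the component, so that both projections share one
  argument; \<open>K\<close> is left abstract because they are different constructors.\<close>

lemma valid_WithE:
  assumes EA: "cand EA" and EB: "cand EB" and C: "cand C"
    and G: "cands G" and D: "cands D" and disj: "dom G \<inter> dom D = {}"
    and F: "valid G F (with_per EA EB)" and F': "valid (case_nat (Some (if i then EA else EB)) D) F' C"
    and K: "\<And>s p q \<sigma>. s \<simeq> Pair p q \<Longrightarrow> K \<sigma> s \<simeq> F' (case_nat (if i then p else q) \<sigma>)"
  shows "valid (G ++ D) (\<lambda>\<sigma>. K \<sigma> (F \<sigma>)) C"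
proof (rule valid_bilinear[OF C G D disj F])
  interpret cand C by (rule C)
  note iff = with_per_iff[OF EA EB]
  have E: "cand (if i then EA else EB)" using EA EB by simp
  show "C (K \<sigma> s) (K \<sigma> t)" if "env_eq D \<sigma> \<sigma>" "with_per EA EB s t" for \<sigma> s t
  proof -
    from that(2) obtain p q p' q'
      where *: "s \<simeq> Pair p q" "t \<simeq> Pair p' q'" "EA p p'" "EB q q'" unfolding iff by blast
    show ?thesis
      by (rule conv[OF K[OF *(1)] K[OF *(2)] valid_cong[OF F']])
        (use * that(1) in \<open>simp add: env_eq_case_nat\<close>)
  qed
  show "valid D (\<lambda>\<sigma>. K \<sigma> s) C" if "with_per EA EB s s" for s
  proof -
    from that obtain p q p' q'
      where *: "s \<simeq> Pair p q" "EA p p'" "EB q q'" unfolding iff by blast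
    then have "(if i then EA else EB) (if i then p else q) (if i then p else q)"
      using cand.refl_left[OF EA] cand.refl_left[OF EB] by simp
    from valid_inst[OF F' this] show ?thesis by (rule valid_conv[OF C _ K[OF *(1)]])
  qed
  show "C (K \<sigma> (\<omega> s t)) (\<omega> (K \<sigma> s) (K \<sigma> t))"
    if "env_eq D \<sigma> \<sigma>" "lin_op \<omega>" "with_per EA EB s s" "with_per EA EB t t" for \<sigma> \<omega> s t
  proof -
    from that(3,4) obtain p q p1 q1 p' q' p2 q2
      where *: "s \<simeq> Pair p q" "t \<simeq> Pair p' q'" "EA p p1" "EB q q1" "EA p' p2" "EB q' q2"
      unfolding iff by blast
    then have dom: "(if i then EA else EB) (if i then p else q) (if i then p else q)"
        "(if i then EA else EB) (if i then p' else q') (if i then p' else q')"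
      using cand.refl_left[OF EA] cand.refl_left[OF EB] by simp_all
    have "K \<sigma> (\<omega> s t) \<simeq> F' (case_nat (\<omega> (if i then p else q) (if i then p' else q')) \<sigma>)"
      using K[OF conv_Pair_op[OF that(2) *(1,2)], of \<sigma>] by (simp split: if_splits)
    then show ?thesis
      by (rule conv[OF _ conv_op[OF that(2) K[OF *(1)] K[OF *(2)]]
          valid_bind_lin[OF E F' that(1,2) dom]])
  qed
qed

text \<open>The frame property gives linearity in the principal argument everywhere. What remains is
  that the generating equations are respected and that both of their ends give valid functions of
  the environment.\<close>

lemma valid_free:
  assumes C: "cand C" and G: "cands G" and D: "cands D" and disj: "dom G \<inter> dom D = {}"
    and F: "valid G F (free R)"
    and frame: "\<And>\<sigma>. frame (K \<sigma>)"
    and K1: "\<And>\<sigma> s t. env_eq D \<sigma> \<sigma> \<Longrightarrow> R s t \<Longrightarrow> C (K \<sigma> s) (K \<sigma> t)"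
    and K2: "\<And>s t. R s t \<Longrightarrow> valid D (\<lambda>\<sigma>. K \<sigma> s) C \<and> valid D (\<lambda>\<sigma>. K \<sigma> t) C"
  shows "valid (G ++ D) (\<lambda>\<sigma>. K \<sigma> (F \<sigma>)) C"
proof (rule valid_bilinear[OF C G D disj F])
  show K1': "C (K \<sigma> s) (K \<sigma> t)" if "env_eq D \<sigma> \<sigma>" "free R s t" for \<sigma> s t
    by (rule free_elim[OF C frame K1[OF that(1)] that(2)])
  show "valid D (\<lambda>\<sigma>. K \<sigma> s) C" if "free R s s" for s
  proof -
    \<comment> \<open>The same statement twice, to fit the shape of \<open>free_dom\<close> on the
      reflexive pair.\<close>
    have "valid D (\<lambda>\<sigma>. K \<sigma> s) C \<and> valid D (\<lambda>\<sigma>. K \<sigma> s) C"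
      using that K2
    proof (rule free_dom)
      show "valid D (\<lambda>\<sigma>. K \<sigma> s) C" if "s \<simeq> t" "valid D (\<lambda>\<sigma>. K \<sigma> t) C" for s t
        by (rule valid_conv[OF C that(2)]) (use frame that(1) in \<open>simp add: frame_def\<close>)
      show "valid D (\<lambda>\<sigma>. K \<sigma> (s \<boxplus> t)) C"
        if "valid D (\<lambda>\<sigma>. K \<sigma> s) C" "valid D (\<lambda>\<sigma>. K \<sigma> t) C" for s t
        by (rule valid_conv[OF C valid_Sum[OF C D that] frame_sum[OF frame equivclp_refl equivclp_refl]])
      show "valid D (\<lambda>\<sigma>. K \<sigma> (a \<bullet>\<^sub>s s)) C" if "valid D (\<lambda>\<sigma>. K \<sigma> s) C" for a s
        by (rule valid_conv[OF C valid_Scal[OF C D that] frame_scal[OF frame equivclp_refl]])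
    qed
    then show ?thesis ..
  qed
  show "C (K \<sigma> (\<omega> s t)) (\<omega> (K \<sigma> s) (K \<sigma> t))"
    if "env_eq D \<sigma> \<sigma>" "lin_op \<omega>" "free R s s" "free R t t" for \<sigma> \<omega> s t
    by (rule cand.conv_left[OF C frame_op[OF frame that(2)]
          cand.op_closed[OF C that(2) K1'[OF that(1,3)] K1'[OF that(1,4)]]])
qed

lemma frame_TensorE: "frame (\<lambda>s. TensorE s A B w)"
  by (simp add: frame_def conv_TensorE conv_red R_Sum_TensorE R_Scal_TensorE)

lemma frame_PlusE: "frame (\<lambda>s. PlusE s A v B w)"
  by (simp add: frame_def conv_PlusE conv_red R_Sum_PlusE R_Scal_PlusE)

lemma valid_TensorE:
  assumes EA: "cand EA" and EB: "cand EB" and C: "cand C"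
    and G: "cands G" and D: "cands D" and disj: "dom G \<inter> dom D = {}"
    and F: "valid G F (free (tensor_gen EA EB))"
    and F': "valid (case_nat (Some EB) (case_nat (Some EA) D)) F' C"
    and b: "\<And>\<sigma> u v. subst2 u v (b \<sigma>) = F' (case_nat v (case_nat u \<sigma>))"
  shows "valid (G ++ D) (\<lambda>\<sigma>. TensorE (F \<sigma>) A B (b \<sigma>)) C"
proof (rule valid_free[OF C G D disj F, where K = "\<lambda>\<sigma> s. TensorE s A B (b \<sigma>)"])
  interpret cand C by (rule C)
  let ?K = "\<lambda>\<sigma> s. TensorE s A B (b \<sigma>)"
  have \<beta>: "?K \<sigma> (Tens u v) \<simeq> F' (case_nat v (case_nat u \<sigma>))" for \<sigma> u v
    using conv_red[OF R_Tens, of u v A B "b \<sigma>"] by (simp add: b)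
  have \<beta>\<omega>: "?K \<sigma> (\<omega> (Tens u v) (Tens u' v')) \<simeq>
      \<omega> (F' (case_nat v (case_nat u \<sigma>))) (F' (case_nat v' (case_nat u' \<sigma>)))"
    if "lin_op \<omega>" for \<omega> \<sigma> u v u' v'
    by (rule equivclp_trans[OF frame_op[OF frame_TensorE that] conv_op[OF that \<beta> \<beta>]])
  show "frame (?K \<sigma>)" for \<sigma>
    by (rule frame_TensorE)
  have inst: "valid D (\<lambda>\<sigma>. F' (case_nat v (case_nat u \<sigma>))) C" if "EA u u" "EB v v" for u v
    by (rule valid_inst[OF valid_inst[OF F' that(2)] that(1)])
  have base: "valid D (\<lambda>\<sigma>. ?K \<sigma> (Tens u v)) C" if "EA u u" "EB v v" for u v
    by (rule valid_conv[OF C inst[OF that] \<beta>])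
  have base_op: "valid D (\<lambda>\<sigma>. ?K \<sigma> (\<omega> (Tens u v) (Tens u' v'))) C"
    if "lin_op \<omega>" "EA u u" "EB v v" "EA u' u'" "EB v' v'" for \<omega> u v u' v'
    by (rule valid_conv[OF C valid_op[OF C D that(1) inst[OF that(2,3)] inst[OF that(4,5)]] \<beta>\<omega>[OF that(1)]])
  show "C (?K \<sigma> s) (?K \<sigma> t)" if \<sigma>: "env_eq D \<sigma> \<sigma>" and "tensor_gen EA EB s t" for \<sigma> s t
    using that(2)
  proof cases
    case (tensor_base u u' v v')
    have "C (F' (case_nat v (case_nat u \<sigma>))) (F' (case_nat v' (case_nat u' \<sigma>)))"
      by (rule valid_cong[OF F']) (simp add: env_eq_case_nat tensor_base \<sigma>)
    then show ?thesis unfolding tensor_base(1,2) by (rule conv[OF \<beta> \<beta>])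
  next
    case (tensor_left \<omega> u u' v)
    \<comment> \<open>The second factor \<open>v\<close>, at index 0, is frozen by
      \<open>valid_inst\<close>; the body is then linear in the first factor.\<close>
    show ?thesis unfolding tensor_left(1,2)
      by (rule conv[OF \<beta> \<beta>\<omega>[OF tensor_left(3)] valid_bind_lin[OF EA
            valid_inst[OF F' tensor_left(6)] \<sigma> tensor_left(3-5)]])
  next
    case (tensor_right \<omega> u v v')
    \<comment> \<open>Here the first factor is stored in the environment, which leaves linearity in
      index 0.\<close>
    have "env_eq (case_nat (Some EA) D) (case_nat u \<sigma>) (case_nat u \<sigma>)"
      by (simp add: env_eq_case_nat tensor_right(4) \<sigma>)
    from valid_bind_lin[OF EB F' this tensor_right(3,5,6)]
    show ?thesis unfolding tensor_right(1,2) by (rule conv[OF \<beta> \<beta>\<omega>[OF tensor_right(3)]])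
  qed
  show "valid D (\<lambda>\<sigma>. ?K \<sigma> s) C \<and> valid D (\<lambda>\<sigma>. ?K \<sigma> t) C" if "tensor_gen EA EB s t" for s t
    using that
  proof cases
    case (tensor_base u u' v v')
    show ?thesis unfolding tensor_base(1,2)
      by (rule conjI) (rule base cand.refl_left[OF EA tensor_base(3)] cand.refl_left[OF EB tensor_base(4)]
          cand.refl_right[OF EA tensor_base(3)] cand.refl_right[OF EB tensor_base(4)])+
  next
    case (tensor_left \<omega> u u' v)
    show ?thesis unfolding tensor_left(1,2)
      by (rule conjI[OF base base_op]) (simp_all add: tensor_left(3-) cand.op_closed[OF EA])
  next
    case (tensor_right \<omega> u v v')
    show ?thesis unfolding tensor_right(1,2)
      by (rule conjI[OF base base_op]) (simp_all add: tensor_right(3-) cand.op_closed[OF EB])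
  qed
qed

text \<open>The branches may share \<open>D\<close> because a generator enters only one of them, so
  each variable of \<open>D\<close> is still used linearly.\<close>

lemma valid_PlusE:
  assumes EA: "cand EA" and EB: "cand EB" and C: "cand C"
    and G: "cands G" and D: "cands D" and disj: "dom G \<inter> dom D = {}"
    and F: "valid G F (free (plus_gen EA EB))"
    and F1: "valid (case_nat (Some EA) D) F1 C" and F2: "valid (case_nat (Some EB) D) F2 C"
    and b1: "\<And>\<sigma> u. subst1 u (b1 \<sigma>) = F1 (case_nat u \<sigma>)"
    and b2: "\<And>\<sigma> u. subst1 u (b2 \<sigma>) = F2 (case_nat u \<sigma>)"
  shows "valid (G ++ D) (\<lambda>\<sigma>. PlusE (F \<sigma>) A (b1 \<sigma>) B (b2 \<sigma>)) C"
proof (rule valid_free[OF C G D disj F, where K = "\<lambda>\<sigma> s. PlusE s A (b1 \<sigma>) B (b2 \<sigma>)"])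
  interpret cand C by (rule C)
  let ?K = "\<lambda>\<sigma> s. PlusE s A (b1 \<sigma>) B (b2 \<sigma>)"
  have \<beta>1: "?K \<sigma> (InL u) \<simeq> F1 (case_nat u \<sigma>)" for \<sigma> u
    using conv_red[OF R_PlusL, of u A "b1 \<sigma>"] by (simp add: b1)
  have \<beta>2: "?K \<sigma> (InR u) \<simeq> F2 (case_nat u \<sigma>)" for \<sigma> u
    using conv_red[OF R_PlusR, of u A _ B "b2 \<sigma>"] by (simp add: b2)
  have \<beta>\<omega>1: "?K \<sigma> (\<omega> (InL u) (InL u')) \<simeq> \<omega> (F1 (case_nat u \<sigma>)) (F1 (case_nat u' \<sigma>))"
    if "lin_op \<omega>" for \<omega> \<sigma> u u'
    by (rule equivclp_trans[OF frame_op[OF frame_PlusE that] conv_op[OF that \<beta>1 \<beta>1]])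
  have \<beta>\<omega>2: "?K \<sigma> (\<omega> (InR u) (InR u')) \<simeq> \<omega> (F2 (case_nat u \<sigma>)) (F2 (case_nat u' \<sigma>))"
    if "lin_op \<omega>" for \<omega> \<sigma> u u'
    by (rule equivclp_trans[OF frame_op[OF frame_PlusE that] conv_op[OF that \<beta>2 \<beta>2]])
  have base1: "valid D (\<lambda>\<sigma>. ?K \<sigma> (InL u)) C" if "EA u u" for u
    by (rule valid_conv[OF C valid_inst[OF F1 that] \<beta>1])
  have base2: "valid D (\<lambda>\<sigma>. ?K \<sigma> (InR u)) C" if "EB u u" for u
    by (rule valid_conv[OF C valid_inst[OF F2 that] \<beta>2])
  show "frame (?K \<sigma>)" for \<sigma>
    by (rule frame_PlusE)
  show "C (?K \<sigma> s) (?K \<sigma> t)" if \<sigma>: "env_eq D \<sigma> \<sigma>" and "plus_gen EA EB s t" for \<sigma> s t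
    using that(2)
  proof cases
    case (plus_inl u u')
    show ?thesis unfolding plus_inl(1,2)
      by (rule conv[OF \<beta>1 \<beta>1 valid_cong[OF F1]]) (simp add: env_eq_case_nat plus_inl \<sigma>)
  next
    case (plus_inr u u')
    show ?thesis unfolding plus_inr(1,2)
      by (rule conv[OF \<beta>2 \<beta>2 valid_cong[OF F2]]) (simp add: env_eq_case_nat plus_inr \<sigma>)
  next
    case (plus_inl_op \<omega> u u')
    show ?thesis unfolding plus_inl_op(1,2)
      by (rule conv[OF \<beta>1 \<beta>\<omega>1[OF plus_inl_op(3)] valid_bind_lin[OF EA F1 \<sigma> plus_inl_op(3-)]])
  next
    case (plus_inr_op \<omega> u u')
    show ?thesis unfolding plus_inr_op(1,2)
      by (rule conv[OF \<beta>2 \<beta>\<omega>2[OF plus_inr_op(3)] valid_bind_lin[OF EB F2 \<sigma> plus_inr_op(3-)]])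
  qed
  show "valid D (\<lambda>\<sigma>. ?K \<sigma> s) C \<and> valid D (\<lambda>\<sigma>. ?K \<sigma> t) C" if "plus_gen EA EB s t" for s t
    using that
  proof cases
    case (plus_inl u u')
    show ?thesis unfolding plus_inl(1,2)
      by (rule conjI[OF base1[OF cand.refl_left] base1[OF cand.refl_right]]) (rule EA plus_inl)+
  next
    case (plus_inr u u')
    show ?thesis unfolding plus_inr(1,2)
      by (rule conjI[OF base2[OF cand.refl_left] base2[OF cand.refl_right]]) (rule EB plus_inr)+
  next
    case (plus_inl_op \<omega> u u')
    show ?thesis unfolding plus_inl_op(1,2)
      by (rule conjI[OF base1[OF cand.op_closed[OF EA plus_inl_op(3-)]]],
          rule valid_conv[OF C valid_op[OF C D plus_inl_op(3) valid_inst[OF F1 plus_inl_op(4)]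
            valid_inst[OF F1 plus_inl_op(5)]] \<beta>\<omega>1[OF plus_inl_op(3)]])
  next
    case (plus_inr_op \<omega> u u')
    show ?thesis unfolding plus_inr_op(1,2)
      by (rule conjI[OF base2[OF cand.op_closed[OF EB plus_inr_op(3-)]]],
          rule valid_conv[OF C valid_op[OF C D plus_inr_op(3) valid_inst[OF F2 plus_inr_op(4)]
            valid_inst[OF F2 plus_inr_op(5)]] \<beta>\<omega>2[OF plus_inr_op(3)]])
  qed
qed

section \<open>The fundamental lemma\<close>

text \<open>\<open>\<tau>\<close> is the syntactic and \<open>\<rho>\<close> the semantic valuation of the propositional variables; the
  former is needed for the type annotation of abstractions, which sums must preserve.\<close>

primrec interp :: "fml \<Rightarrow> (nat \<Rightarrow> fml) \<Rightarrow> (nat \<Rightarrow> 's::semiring per) \<Rightarrow> 's per" where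
  "interp (PVar n) = (\<lambda>\<tau> \<rho>. \<rho> n)"
| "interp One = (\<lambda>\<tau> \<rho>. one_per)"
| "interp (Lolli A B) = (\<lambda>\<tau> \<rho>. lolli_per (psubst \<tau> A) (interp A \<tau> \<rho>) (interp B \<tau> \<rho>))"
| "interp (Tensor A B) = (\<lambda>\<tau> \<rho>. free (tensor_gen (interp A \<tau> \<rho>) (interp B \<tau> \<rho>)))"
| "interp Top = (\<lambda>\<tau> \<rho>. top_per)"
| "interp Zero = (\<lambda>\<tau> \<rho> _ _. False)"
| "interp (With A B) = (\<lambda>\<tau> \<rho>. with_per (interp A \<tau> \<rho>) (interp B \<tau> \<rho>))"
| "interp (Plus A B) = (\<lambda>\<tau> \<rho>. free (plus_gen (interp A \<tau> \<rho>) (interp B \<tau> \<rho>)))"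
| "interp (All A) = (\<lambda>\<tau> \<rho>. all_per (\<lambda>A' C. interp A (case_nat A' \<tau>) (case_nat C \<rho>)))"

section \<open>Substitution properties of the interpretation\<close>

lemma cand_case_nat: "cand C \<Longrightarrow> (\<And>n. cand (\<rho> n)) \<Longrightarrow> cand (case_nat C \<rho> n)"
  by (cases n) simp_all

lemma cand_interp: "(\<And>n. cand (\<rho> n)) \<Longrightarrow> cand (interp A \<tau> \<rho>)"
proof (induction A arbitrary: \<tau> \<rho>)
  case (All A)
  show ?case unfolding interp.simps
    by (rule cand_all, rule All.IH, rule cand_case_nat) (use All.prems in simp_all)
qed (simp_all add: cand_one cand_lolli cand_free cand_top cand_empty cand_with)

lemma interp_pren: "interp (pren r A) \<tau> \<rho> = interp A (\<tau> \<circ> r) (\<rho> \<circ> r)"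
  by (induction A arbitrary: \<tau> \<rho> r) (simp_all add: case_nat_up_ren psubst_pren)

lemma interp_pren_Suc: "interp (pren Suc A) (case_nat A' \<tau>) (case_nat C \<rho>) = interp A \<tau> \<rho>"
  by (simp add: interp_pren case_nat_o_Suc)

text \<open>Substituting in a type means reinterpreting its variables. Both valuations change:
  annotations see the substituted types, candidates see their interpretations.\<close>

lemma interp_psubst:
  "interp (psubst \<tau>' A) \<tau> \<rho> = interp A (psubst \<tau> \<circ> \<tau>') (\<lambda>n. interp (\<tau>' n) \<tau> \<rho>)"
proof (induction A arbitrary: \<tau> \<rho> \<tau>')
  case (All A)
  have psubst: "psubst (case_nat A' \<tau>) \<circ> up_psubst \<tau>' = case_nat A' (psubst \<tau> \<circ> \<tau>')" for A'
    by (rule ext) (simp add: up_psubst_def psubst_pren case_nat_o_Suc split: nat.split)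
  have interp: "(\<lambda>n. interp (up_psubst \<tau>' n) (case_nat A' \<tau>) (case_nat C \<rho>)) =
      case_nat C (\<lambda>n. interp (\<tau>' n) \<tau> \<rho>)" for A' C
    by (rule ext) (simp add: up_psubst_def interp_pren_Suc split: nat.split)
  show ?case by (simp only: psubst.simps interp.simps All.IH psubst interp)
qed (simp_all add: psubst_psubst)

text \<open>The instance needed for type application: the pair of a type and its own interpretation
  is one of those over which \<open>all_per\<close> ranges.\<close>

lemma interp_psubst1:
  "interp (psubst1 A B) \<tau> \<rho> = interp B (case_nat (psubst \<tau> A) \<tau>) (case_nat (interp A \<tau> \<rho>) \<rho>)"
proof -
  have "psubst \<tau> \<circ> case_nat A PVar = case_nat (psubst \<tau> A) \<tau>"
    by (rule ext) (simp split: nat.split)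
  moreover have "(\<lambda>n. interp (case_nat A PVar n) \<tau> \<rho>) = case_nat (interp A \<tau> \<rho>) \<rho>"
    by (rule ext) (simp split: nat.split)
  ultimately show ?thesis by (simp add: psubst1_def interp_psubst)
qed

section \<open>Interpretation of contexts and typed terms\<close>

definition interp_ctx :: "(nat \<Rightarrow> fml) \<Rightarrow> (nat \<Rightarrow> 's::semiring per) \<Rightarrow> ctx \<Rightarrow> 's sctx" where
  "interp_ctx \<tau> \<rho> \<Gamma> x = map_option (\<lambda>A. interp A \<tau> \<rho>) (\<Gamma> x)"

lemma interp_ctx_empty [simp]: "interp_ctx \<tau> \<rho> Map.empty = Map.empty"
  by (rule HOL.ext) (simp add: interp_ctx_def)

lemma interp_ctx_single [simp]: "interp_ctx \<tau> \<rho> [x \<mapsto> A] = [x \<mapsto> interp A \<tau> \<rho>]"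
  by (rule HOL.ext) (simp add: interp_ctx_def)

lemma interp_ctx_ext [simp]:
  "interp_ctx \<tau> \<rho> (A \<rhd> \<Gamma>) = case_nat (Some (interp A \<tau> \<rho>)) (interp_ctx \<tau> \<rho> \<Gamma>)"
  by (rule HOL.ext) (simp add: interp_ctx_def ext_def split: nat.split)

lemma interp_ctx_map_add [simp]:
  "interp_ctx \<tau> \<rho> (\<Gamma> ++ \<Delta>) = interp_ctx \<tau> \<rho> \<Gamma> ++ interp_ctx \<tau> \<rho> \<Delta>"
  by (rule HOL.ext) (simp add: interp_ctx_def map_add_def split: option.split)

lemma interp_ctx_shift:
  "interp_ctx (case_nat A \<tau>) (case_nat C \<rho>) (\<lambda>x. map_option (pren Suc) (\<Gamma> x)) = interp_ctx \<tau> \<rho> \<Gamma>"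
  by (rule HOL.ext) (simp add: interp_ctx_def option.map_comp comp_def interp_pren_Suc)

lemma disj_interp_ctx: "\<Gamma> \<bottom> \<Delta> \<Longrightarrow> dom (interp_ctx \<tau> \<rho> \<Gamma>) \<inter> dom (interp_ctx \<tau> \<rho> \<Delta>) = {}"
  by (auto simp: disj_def interp_ctx_def dom_def)

lemma cands_interp_ctx: "(\<And>n. cand (\<rho> n)) \<Longrightarrow> cands (interp_ctx \<tau> \<rho> \<Gamma>)"
  by (auto simp: cands_def interp_ctx_def cand_interp)

text \<open>The valuations are generalised in the induction since a type abstraction extends both.
  The environment is applied after \<tau>, so its terms are never affected by \<tau>.\<close>

lemma fundamental:
  fixes t :: "'s::semiring trm"
  assumes "\<Gamma> \<turnstile> t \<^bold>: A" and "\<And>n. cand (\<rho> n)"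
  shows "valid (interp_ctx \<tau> \<rho> \<Gamma>) (\<lambda>\<sigma>. tsubst \<sigma> (tpsubst \<tau> t)) (interp A \<tau> \<rho>)"
  using assms
proof (induction arbitrary: \<tau> \<rho> rule: typed.induct)
  case (T_Var x A)
  show ?case unfolding interp_ctx_single tpsubst.simps tsubst.simps by (rule valid_Var)
next
  case (T_Sum \<Gamma> t A u)
  note c = cand_interp[of \<rho>, OF T_Sum.prems] cands_interp_ctx[of \<rho>, OF T_Sum.prems]
  show ?case using valid_Sum[OF c T_Sum.IH] T_Sum.prems by simp
next
  case (T_Scal \<Gamma> t A a)
  note c = cand_interp[of \<rho>, OF T_Scal.prems] cands_interp_ctx[of \<rho>, OF T_Scal.prems]
  show ?case using valid_Scal[OF c T_Scal.IH] T_Scal.prems by simp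
next
  case (T_Star a)
  show ?case by (simp add: valid_Star)
next
  case (T_OneE \<Gamma> t \<Delta> u A)
  note c = cand_interp[of \<rho>, OF T_OneE.prems] cands_interp_ctx[of \<rho>, OF T_OneE.prems]
  show ?case
    using valid_OneE[OF c(1,2,2) disj_interp_ctx[OF T_OneE.hyps(3)]] T_OneE.IH T_OneE.prems by simp
next
  case (T_Lam A \<Gamma> t B)
  note c = cand_interp[of \<rho>, OF T_Lam.prems] cands_interp_ctx[of \<rho>, OF T_Lam.prems]
  show ?case
    unfolding interp.simps tpsubst.simps tsubst.simps
    by (rule valid_Lam[OF c(1,1,2) T_Lam.IH[OF T_Lam.prems, unfolded interp_ctx_ext]])
      (rule subst1_tsubst_up)
next
  case (T_App \<Gamma> t A B \<Delta> u)
  note c = cand_interp[of \<rho>, OF T_App.prems] cands_interp_ctx[of \<rho>, OF T_App.prems]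
  show ?case
    unfolding interp_ctx_map_add tpsubst.simps tsubst.simps
    by (rule valid_App[OF c(1,2,2) disj_interp_ctx[OF T_App.hyps(3)]
          T_App.IH(1)[OF T_App.prems, unfolded interp.simps] T_App.IH(2)[OF T_App.prems]])
next
  case (T_Tens \<Gamma> t A \<Delta> u B)
  note c = cands_interp_ctx[of \<rho>, OF T_Tens.prems]
  show ?case
    using valid_Tens[OF c c disj_interp_ctx[OF T_Tens.hyps(3)]] T_Tens.IH T_Tens.prems by simp
next
  case (T_TensorE \<Gamma> t A B \<Delta> u C)
  note c = cand_interp[of \<rho>, OF T_TensorE.prems] cands_interp_ctx[of \<rho>, OF T_TensorE.prems]
  show ?case
    unfolding interp_ctx_map_add tpsubst.simps tsubst.simps
    by (rule valid_TensorE[OF c(1,1,1,2,2) disj_interp_ctx[OF T_TensorE.hyps(3)]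
          T_TensorE.IH(1)[OF T_TensorE.prems, unfolded interp.simps]
          T_TensorE.IH(2)[OF T_TensorE.prems, unfolded interp_ctx_ext]])
      (rule subst2_tsubst_up)
next
  case (T_Unit \<Gamma>)
  show ?case by (simp add: valid_Unit)
next
  case (T_ZeroE \<Gamma> t \<Delta> C)
  show ?case
    unfolding interp_ctx_map_add
    by (rule valid_ZeroE[OF disj_interp_ctx[OF T_ZeroE.hyps(3)]
          T_ZeroE.IH[OF T_ZeroE.prems, unfolded interp.simps]])
next
  case (T_Pair \<Gamma> t A u B)
  note c = cand_interp[of \<rho>, OF T_Pair.prems]
  show ?case using valid_Pair[OF c c T_Pair.IH] T_Pair.prems by simp
next
  case (T_WithE1 \<Gamma> t A B \<Delta> u C)
  note c = cand_interp[of \<rho>, OF T_WithE1.prems] cands_interp_ctx[of \<rho>, OF T_WithE1.prems]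
  show ?case
    unfolding interp_ctx_map_add tpsubst.simps tsubst.simps
  proof (rule valid_WithE[where i = True and EA = "interp A \<tau> \<rho>" and EB = "interp B \<tau> \<rho>"
        and F' = "\<lambda>\<sigma>. tsubst \<sigma> (tpsubst \<tau> u)"
        and K = "\<lambda>\<sigma> s. WithE1 s (psubst \<tau> A) (tsubst (up_tsubst \<sigma>) (tpsubst \<tau> u))",
        OF c(1,1,1,2,2) disj_interp_ctx[OF T_WithE1.hyps(3)]])
    show "WithE1 s (psubst \<tau> A) (tsubst (up_tsubst \<sigma>) (tpsubst \<tau> u)) \<simeq>
        tsubst (case_nat (if True then p else q) \<sigma>) (tpsubst \<tau> u)"
      if "s \<simeq> Pair p q" for s p q \<sigma>
      using conv_fst[OF that] by (simp add: subst1_tsubst_up[symmetric])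
  qed (use T_WithE1.IH T_WithE1.prems in simp_all)
next
  case (T_WithE2 \<Gamma> t A B \<Delta> u C)
  note c = cand_interp[of \<rho>, OF T_WithE2.prems] cands_interp_ctx[of \<rho>, OF T_WithE2.prems]
  show ?case
    unfolding interp_ctx_map_add tpsubst.simps tsubst.simps
  proof (rule valid_WithE[where i = False and EA = "interp A \<tau> \<rho>" and EB = "interp B \<tau> \<rho>"
        and F' = "\<lambda>\<sigma>. tsubst \<sigma> (tpsubst \<tau> u)"
        and K = "\<lambda>\<sigma> s. WithE2 s (psubst \<tau> B) (tsubst (up_tsubst \<sigma>) (tpsubst \<tau> u))",
        OF c(1,1,1,2,2) disj_interp_ctx[OF T_WithE2.hyps(3)]])
    show "WithE2 s (psubst \<tau> B) (tsubst (up_tsubst \<sigma>) (tpsubst \<tau> u)) \<simeq>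
        tsubst (case_nat (if False then p else q) \<sigma>) (tpsubst \<tau> u)"
      if "s \<simeq> Pair p q" for s p q \<sigma>
      using conv_snd[OF that] by (simp add: subst1_tsubst_up[symmetric])
  qed (use T_WithE2.IH T_WithE2.prems in simp_all)
next
  case (T_InL \<Gamma> t A B)
  show ?case
    using valid_InL[OF cands_interp_ctx[of \<rho>, OF T_InL.prems] T_InL.IH] T_InL.prems by simp
next
  case (T_InR \<Gamma> t B A)
  show ?case
    using valid_InR[OF cands_interp_ctx[of \<rho>, OF T_InR.prems] T_InR.IH] T_InR.prems by simp
next
  case (T_PlusE \<Gamma> t A B \<Delta> u C v)
  note c = cand_interp[of \<rho>, OF T_PlusE.prems] cands_interp_ctx[of \<rho>, OF T_PlusE.prems]
  show ?case
    unfolding interp_ctx_map_add tpsubst.simps tsubst.simps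
    by (rule valid_PlusE[OF c(1,1,1,2,2) disj_interp_ctx[OF T_PlusE.hyps(4)]
          T_PlusE.IH(1)[OF T_PlusE.prems, unfolded interp.simps]
          T_PlusE.IH(2)[OF T_PlusE.prems, unfolded interp_ctx_ext]
          T_PlusE.IH(3)[OF T_PlusE.prems, unfolded interp_ctx_ext]])
      (rule subst1_tsubst_up)+
next
  case (T_TLam \<Gamma> t A)
  have \<rho>: "cand (case_nat C \<rho> n)" if "cand C" for C n
    by (rule cand_case_nat[OF that T_TLam.prems])
  show ?case
    unfolding interp.simps tpsubst.simps tsubst.simps
  proof (rule valid_TLam[where F = "\<lambda>A' \<sigma>. tsubst \<sigma> (tpsubst (case_nat A' \<tau>) t)"])
    show "cand (interp A (case_nat A' \<tau>) (case_nat C \<rho>))" if "cand C" for A' C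
      by (rule cand_interp) (rule \<rho>[OF that])
    show "cands (interp_ctx \<tau> \<rho> \<Gamma>)"
      by (rule cands_interp_ctx[of \<rho>, OF T_TLam.prems])
    show "valid (interp_ctx \<tau> \<rho> \<Gamma>) (\<lambda>\<sigma>. tsubst \<sigma> (tpsubst (case_nat A' \<tau>) t))
        (interp A (case_nat A' \<tau>) (case_nat C \<rho>))" if "cand C" for A' C
      using T_TLam.IH[of "case_nat C \<rho>" "case_nat A' \<tau>", OF \<rho>[OF that]]
      unfolding interp_ctx_shift .
  qed (rule tpsubst1_tsubst_up)
next
  case (T_TApp \<Gamma> t B A)
  show ?case
    unfolding interp_psubst1 tpsubst.simps tsubst.simps
  proof (rule valid_TApp[where EB = "\<lambda>A' C. interp B (case_nat A' \<tau>) (case_nat C \<rho>)"])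
    show "cand (interp B (case_nat A' \<tau>) (case_nat C \<rho>))" if "cand C" for A' C
      by (rule cand_interp) (rule cand_case_nat[OF that T_TApp.prems])
    show "cand (interp A \<tau> \<rho>)"
      by (rule cand_interp[of \<rho>, OF T_TApp.prems])
    show "cands (interp_ctx \<tau> \<rho> \<Gamma>)"
      by (rule cands_interp_ctx[of \<rho>, OF T_TApp.prems])
  qed (use T_TApp.IH T_TApp.prems in simp)
qed

text \<open>\<open>One\<close> and \<open>With\<close> record convertibility to an introduction in
  their relations, so related terms can be rebuilt and compared. The extensional and free-module
  relations, which may go beyond conversion, do not occur in \<open>VV\<close>.\<close>

lemma interp_VV_conv:
  assumes "A \<in> VV" and "\<And>n. cand (\<rho> n)"
  shows "interp A \<tau> \<rho> s t \<Longrightarrow> s \<simeq> t"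
  using assms(1)
proof (induction arbitrary: s t)
  case VV_One
  then obtain a where "s \<simeq> Star a" "t \<simeq> Star a" by (auto simp: one_per_def)
  then show ?case by (rule equivclp_trans[OF _ equivclp_sym])
next
  case (VV_With A B)
  from VV_With.prems obtain p q p' q'
    where *: "s \<simeq> Pair p q" "t \<simeq> Pair p' q'" "interp A \<tau> \<rho> p p'" "interp B \<tau> \<rho> q q'"
    unfolding interp.simps with_per_iff[OF cand_interp[OF assms(2)] cand_interp[OF assms(2)]]
    by auto
  have "Pair p q \<simeq> Pair p' q'" by (rule conv_Pair[OF VV_With.IH(1)[OF *(3)] VV_With.IH(2)[OF *(4)]])
  then show ?case by (rule equivclp_trans[OF *(1) equivclp_trans[OF _ equivclp_sym[OF *(2)]]])
qed

lemma linearity_op: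
  fixes t :: "'s::semiring trm"
  assumes B: "B \<in> VV" and t: "[x \<mapsto> A] \<turnstile> t \<^bold>: B"
    and u: "Map.empty \<turnstile> u1 \<^bold>: A" "Map.empty \<turnstile> u2 \<^bold>: A" and \<omega>: "lin_op \<omega>"
  shows "fsubst x (\<omega> u1 u2) t \<simeq> \<omega> (fsubst x u1 t) (fsubst x u2 t)"
proof -
  \<comment> \<open>Propositional variables may occur free in \<open>A\<close>; any candidate
    interprets them, and \<open>one_per\<close> is one at hand.\<close>
  define \<rho> :: "nat \<Rightarrow> 's per" where "\<rho> = (\<lambda>_. one_per)"
  have \<rho>: "cand (\<rho> n)" for n by (simp add: \<rho>_def cand_one)
  let ?E = "interp A PVar \<rho>"
  have dom: "?E u u" if "Map.empty \<turnstile> u \<^bold>: A" for u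
  proof -
    \<comment> \<open>In the empty context every environment is admissible; \<open>Var\<close> and
      \<open>PVar\<close> are chosen because they act as identities.\<close>
    have "?E (tsubst Var (tpsubst PVar u)) (tsubst Var (tpsubst PVar u))"
      by (rule valid_cong[OF fundamental[OF that \<rho>]]) (simp add: env_eq_def)
    then show ?thesis by simp
  qed
  note v = fundamental[where \<tau> = PVar and \<rho> = \<rho>, OF t \<rho>]
  \<comment> \<open>The context has \<open>x\<close> as its only variable, so agreement elsewhere is
    vacuous and the updates are exactly those of \<open>fsubst\<close>.\<close>
  have "env_lin \<omega> x [x \<mapsto> ?E] (Var(x := \<omega> u1 u2)) (Var(x := u1)) (Var(x := u2))"
    using cand.op_closed[OF cand_interp[OF \<rho>] \<omega> dom[OF u(1)] dom[OF u(2)]] dom u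
    by (simp add: env_lin_def env_eq_def)
  then have "interp B PVar \<rho> (fsubst x (\<omega> u1 u2) t) (\<omega> (fsubst x u1 t) (fsubst x u2 t))"
    using valid_lin[OF v[unfolded interp_ctx_single tpsubst_PVar] \<omega>] unfolding fsubst_def by blast
  with B \<rho> show ?thesis by (rule interp_VV_conv)
qed

theorem theorem7:
  fixes A B :: fml
    and x :: nat
    and t u1 u2 :: "'s::{semiring_0, monoid_mult} trm"
  assumes "B \<in> VV"
    and "[x \<mapsto> A] \<turnstile> t \<^bold>: B"
    and "Map.empty \<turnstile> u1 \<^bold>: A"
    and "Map.empty \<turnstile> u2 \<^bold>: A"
  shows "fsubst x (u1 \<boxplus> u2) t \<simeq> fsubst x u1 t \<boxplus> fsubst x u2 t \<and>
    (\<forall>a::'s. (\<forall>b. a * b = b * a) \<longrightarrow> fsubst x (a \<bullet>\<^sub>s u1) t \<simeq> a \<bullet>\<^sub>s fsubst x u1 t)"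
proof (intro conjI allI impI)
  show "fsubst x (u1 \<boxplus> u2) t \<simeq> fsubst x u1 t \<boxplus> fsubst x u2 t"
    by (rule linearity_op[OF assms lin_op_Sum])
  show "fsubst x (a \<bullet>\<^sub>s u1) t \<simeq> a \<bullet>\<^sub>s fsubst x u1 t" if "\<forall>b. a * b = b * a" for a
    using linearity_op[OF assms lin_op_Scal, of a] that by blast
qed

end
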